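(* Let $\Omega\subset\mathbb{C}^2$ be a smoothly bounded domain. If $\Omega$ is sesquiconvex at $p_0\in b\Omega$, then $\Omega$ admits a smooth local defining function $\rho\colon U\to\mathbb{R}$ near $p_0$ which is plurisubharmonic on $\bar\Omega\cap U$.
   Context: "Smooth" means $\mathcal{C}^\infty$; "smoothly bounded" means that $b\Omega$ is smooth. A smooth function $\rho\colon U\to\mathbb{R}$ is a local defining function for $\Omega$ near $p_0\in b\Omega$ if $U$ is an open neighborhood of $p_0$, $\Omega\cap U=\{\rho<0\}$, and $d\rho\ne0$ on $b\Omega\cap U$. Coordinates are $(z,w)=(z^1,z^2)$. For $(1,0)$ vector fields, $H_f(A,B)=\sum_{j,k}\frac{\partial^2f}{\partial z^j\partial\bar z^k}A^j\overline{B^k}$. For real vector fields $V,W$ on an open subset of $\mathbb{C}^2\cong\mathbb{R}^4$ with real coordinates $t^1,\dots,t^4$, $Q_f(V,W)=\sum_{\mu,\kappa}\frac{\partial^2f}{\partial t^\mu\partial t^\kappa}V^\mu W^\kappa$ (real Hessian). A "holomorphic tangential vector field" is a smooth $(1,0)$ vector field $L$ with $L\rho=0$ on $b\Omega$. $\Omega$ is pseudoconvex at $p_0$ if $H_\rho(L,L)\ge0$ on $b\Omega$ near $p_0$ for all holomorphic tangential $L$. "$\rho$ is plurisubharmonic on $\bar\Omega\cap U$" means that the complex Hessian of $\rho$ is positive semi-definite at every point $q\in\bar\Omega\cap U$. Let $L$ be a nonvanishing holomorphic tangential vector field on $U$ and $N=N_\rho=\frac{1}{\sqrt{|\rho_z|^2+|\rho_w|^2}}\big(\rho_{\bar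 z}\frac{\partial}{\partial z}+\rho_{\bar w}\frac{\partial}{\partial w}\big)$; write $L=\frac12(X+iY)$, $N=\frac12(\nu+iT)$ with real vector fields $X,Y,\nu,T$. Sesquiconvexity: $\Omega$ is sesquiconvex at $p_0$ if $\Omega$ is pseudoconvex at $p_0$ and there exists a smooth local defining function $\rho\colon U\to\mathbb{R}$ for $\Omega$ near $p_0$ such that $$Q_\rho(Y,T)^2+Q_\rho(X,T)^2=\mathcal{O}(H_\rho(L,L))\quad\text{on } b\Omega\cap U.$$ This condition is independent of the choice of the local defining function. Here "$f=\mathcal{O}(g)$ on $b\Omega\cap U$" means: for every $K\Subset b\Omega\cap U$ there is $C>0$ with $|f|\le C|g|$ on $K$. *)

theory Defs
  imports "HOL-Analysis.Analysis"
begin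

text \<open>Functions on an open set \<open>U\<close> are total functions of which only the values on \<open>U\<close> matter:
  for open \<open>U\<close>, every derivative below at a point of \<open>U\<close> depends on \<open>f\<close> only through its
  restriction to \<open>U\<close>. The following two notions are meant for open \<open>U\<close> only.\<close>

primrec Ck_on :: "nat \<Rightarrow> 'a::real_normed_vector set \<Rightarrow> ('a \<Rightarrow> 'b::real_normed_vector) \<Rightarrow> bool" where
  "Ck_on 0 U f \<longleftrightarrow> continuous_on U f"
| "Ck_on (Suc k) U f \<longleftrightarrow> (\<forall>x\<in>U. f differentiable (at x)) \<and>
     (\<forall>v. Ck_on k U (\<lambda>x. frechet_derivative f (at x) v))"

definition smooth_on :: "'a::real_normed_vector set \<Rightarrow> ('a \<Rightarrow> 'b::real_normed_vector) \<Rightarrow> bool" where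
  "smooth_on U f \<longleftrightarrow> (\<forall>k. Ck_on k U f)"

text \<open>The derivations \<open>\<partial>/\<partial>z\<^sup>j\<close> and \<open>\<partial>/\<partial>\<bar>z\<^sup>j\<close>. The type \<open>2\<close> indexes the coordinates
  \<open>(z, w) = (z\<^sup>1, z\<^sup>2)\<close>; \<open>axis j 1\<close> and \<open>axis j \<i>\<close> are the real directions
  of \<open>Re z\<^sup>j\<close> and \<open>Im z\<^sup>j\<close>.\<close>

definition d_z :: "2 \<Rightarrow> (complex^2 \<Rightarrow> complex) \<Rightarrow> complex^2 \<Rightarrow> complex" where
  "d_z j f p = (frechet_derivative f (at p) (axis j 1)
                - \<i> * frechet_derivative f (at p) (axis j \<i>)) / 2"

definition d_zbar :: "2 \<Rightarrow> (complex^2 \<Rightarrow> complex) \<Rightarrow> complex^2 \<Rightarrow> complex" where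
  "d_zbar j f p = (frechet_derivative f (at p) (axis j 1)
                   + \<i> * frechet_derivative f (at p) (axis j \<i>)) / 2"

text \<open>A \<open>(1,0)\<close> vector \<open>\<Sum>\<^sub>j A\<^sup>j \<partial>/\<partial>z\<^sup>j\<close> is represented by \<open>A :: complex^2\<close>, and so is a real
  tangent vector of \<open>\<complex>\<^sup>2 \<cong> \<real>\<^sup>4\<close>, whose real coordinates are its inner products with
  the elements of \<open>Basis\<close>.\<close>

definition complex_hessian :: "(complex^2 \<Rightarrow> real) \<Rightarrow> complex^2 \<Rightarrow> complex^2 \<Rightarrow> complex^2 \<Rightarrow> complex" where
  "complex_hessian f p A B =
     (\<Sum>j\<in>UNIV. \<Sum>k\<in>UNIV. d_z j (d_zbar k (\<lambda>q. complex_of_real (f q))) p * A $ j * cnj (B $ k))"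

definition real_hessian :: "(complex^2 \<Rightarrow> real) \<Rightarrow> complex^2 \<Rightarrow> complex^2 \<Rightarrow> complex^2 \<Rightarrow> real" where
  "real_hessian f p V W =
     (\<Sum>a\<in>Basis. \<Sum>b\<in>Basis.
        frechet_derivative (\<lambda>q. frechet_derivative f (at q) b) (at p) a * (V \<bullet> a) * (W \<bullet> b))"

definition apply_10 :: "complex^2 \<Rightarrow> (complex^2 \<Rightarrow> real) \<Rightarrow> complex^2 \<Rightarrow> complex" where
  "apply_10 A f p = (\<Sum>j\<in>UNIV. A $ j * d_z j (\<lambda>q. complex_of_real (f q)) p)"

text \<open>The real vectors \<open>V\<close>, \<open>W\<close> in the decomposition \<open>A = (V + \<i> W) / 2\<close> of a \<open>(1,0)\<close> vector \<open>A\<close>,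
  where \<open>\<i>\<close> is the scalar of the complexified tangent space. Since
  \<open>\<partial>/\<partial>z\<^sup>j = (\<partial>/\<partial>x\<^sup>j - \<i> \<partial>/\<partial>y\<^sup>j) / 2\<close>, the component \<open>A\<^sup>j = a + \<i> b\<close> contributes
  \<open>a \<partial>/\<partial>x\<^sup>j + b \<partial>/\<partial>y\<^sup>j\<close> to \<open>V\<close> and \<open>b \<partial>/\<partial>x\<^sup>j - a \<partial>/\<partial>y\<^sup>j\<close> to \<open>W\<close>; under
  \<open>\<real>\<^sup>4 \<cong> \<complex>\<^sup>2\<close> these are \<open>A\<^sup>j\<close> and \<open>-\<i> A\<^sup>j\<close>. See \<open>apply_10_decomposition\<close> and
  \<open>decomposition_unique\<close>.\<close>

definition re_part :: "complex^2 \<Rightarrow> complex^2" where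
  "re_part A = A"

definition im_part :: "complex^2 \<Rightarrow> complex^2" where
  "im_part A = (\<chi> j. - \<i> * A $ j)"

lemma apply_10_decomposition:
  assumes "f differentiable (at p)"
  shows "apply_10 A f p =
    (complex_of_real (frechet_derivative f (at p) (re_part A))
     + \<i> * complex_of_real (frechet_derivative f (at p) (im_part A))) / 2"
proof -
  let ?D = "frechet_derivative f (at p)"
  have D: "(f has_derivative ?D) (at p)"
    using assms frechet_derivative_works by blast
  then interpret bounded_linear ?D by (rule has_derivative_bounded_linear)
  have "((\<lambda>q. complex_of_real (f q)) has_derivative (\<lambda>v. complex_of_real (?D v))) (at p)"
    using D by (rule has_derivative_of_real)
  then have DC: "frechet_derivative (\<lambda>q. complex_of_real (f q)) (at p) = (\<lambda>v. complex_of_real (?D v))"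
    by (simp add: frechet_derivative_at[symmetric])
  have exp: "?D B = (\<Sum>j\<in>UNIV. Re (B $ j) * ?D (axis j 1) + Im (B $ j) * ?D (axis j \<i>))" for B :: "complex^2"
  proof -
    have "B = (\<Sum>j\<in>UNIV. Re (B $ j) *\<^sub>R axis j 1 + Im (B $ j) *\<^sub>R axis j \<i>)"
      by (auto simp: vec_eq_iff axis_def complex_eq_iff if_distrib cong: if_cong)
    then have "?D B = ?D (\<Sum>j\<in>UNIV. Re (B $ j) *\<^sub>R axis j 1 + Im (B $ j) *\<^sub>R axis j \<i>)"
      by simp
    then show ?thesis by (simp add: sum add scaleR)
  qed
  show ?thesis
    unfolding apply_10_def d_z_def DC exp[of "re_part A"] exp[of "im_part A"]
    by (simp add: re_part_def im_part_def complex_eq_iff sum.distrib sum_subtractf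
        sum_divide_distrib sum_distrib_left field_simps sum_2)
qed

lemma decomposition_unique:
  assumes "\<And>f. f differentiable (at p) \<Longrightarrow> apply_10 A f p =
    (complex_of_real (frechet_derivative f (at p) V)
     + \<i> * complex_of_real (frechet_derivative f (at p) W)) / 2"
  shows "V = re_part A" and "W = im_part A"
proof -
  have "V \<bullet> b = re_part A \<bullet> b \<and> W \<bullet> b = im_part A \<bullet> b" for b
  proof -
    let ?f = "\<lambda>q::complex^2. q \<bullet> b"
    have d: "(?f has_derivative ?f) (at p)"
      by (rule bounded_linear.has_derivative[OF bounded_linear_inner_left has_derivative_ident])
    have D: "frechet_derivative ?f (at p) = ?f"
      using frechet_derivative_at[OF d] by simp
    have "?f differentiable (at p)" using d by (auto simp: differentiable_def)
    from assms[OF this] apply_10_decomposition[OF this, of A] show ?thesis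
      by (simp add: D complex_eq_iff)
  qed
  then show "V = re_part A" "W = im_part A"
    by (auto intro: euclidean_eqI)
qed

definition local_defining :: "(complex^2) set \<Rightarrow> complex^2 \<Rightarrow> (complex^2) set \<Rightarrow> (complex^2 \<Rightarrow> real) \<Rightarrow> bool" where
  "local_defining \<Omega> p0 U \<rho> \<longleftrightarrow> open U \<and> p0 \<in> U \<and> smooth_on U \<rho> \<and>
     \<Omega> \<inter> U = {p\<in>U. \<rho> p < 0} \<and>
     (\<forall>p\<in>frontier \<Omega> \<inter> U. frechet_derivative \<rho> (at p) \<noteq> (\<lambda>v. 0))"

text \<open>Smoothness of the boundary only; the set \<open>\<Omega>\<close> need not be bounded.\<close>

definition smoothly_bounded_domain :: "(complex^2) set \<Rightarrow> bool" where
  "smoothly_bounded_domain \<Omega> \<longleftrightarrow> open \<Omega> \<and> connected \<Omega> \<and> \<Omega> \<noteq> {} \<and>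
     (\<forall>p\<in>frontier \<Omega>. \<exists>U \<rho>. local_defining \<Omega> p U \<rho>)"

definition holomorphic_tangential ::
  "(complex^2) set \<Rightarrow> (complex^2) set \<Rightarrow> (complex^2 \<Rightarrow> real) \<Rightarrow> (complex^2 \<Rightarrow> complex^2) \<Rightarrow> bool" where
  "holomorphic_tangential \<Omega> U \<rho> L \<longleftrightarrow>
     smooth_on U L \<and> (\<forall>p\<in>frontier \<Omega> \<inter> U. apply_10 (L p) \<rho> p = 0)"

text \<open>For real smooth \<open>\<rho>\<close> the complex Hessian is Hermitian, so its diagonal values are real and
  taking \<open>Re\<close> is only a coercion, here and in \<open>plurisubharmonic_on\<close>. The condition does not depend
  on the choice of the local defining function.\<close>

definition pseudoconvex_at :: "(complex^2) set \<Rightarrow> complex^2 \<Rightarrow> bool" where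
  "pseudoconvex_at \<Omega> p0 \<longleftrightarrow> (\<exists>U \<rho>. local_defining \<Omega> p0 U \<rho> \<and>
     (\<forall>L. holomorphic_tangential \<Omega> U \<rho> L \<longrightarrow>
        (\<forall>\<^sub>F p in nhds p0. p \<in> frontier \<Omega> \<longrightarrow> 0 \<le> Re (complex_hessian \<rho> p (L p) (L p)))))"

definition normal_10 :: "(complex^2 \<Rightarrow> real) \<Rightarrow> complex^2 \<Rightarrow> complex^2" where
  "normal_10 \<rho> p =
     (1 / sqrt (\<Sum>j\<in>UNIV. (cmod (d_z j (\<lambda>q. complex_of_real (\<rho> q)) p))\<^sup>2)) *\<^sub>R
     (\<chi> j. d_zbar j (\<lambda>q. complex_of_real (\<rho> q)) p)"

definition bigO_on ::
  "'a::topological_space set \<Rightarrow> ('a \<Rightarrow> 'b::real_normed_vector) \<Rightarrow> ('a \<Rightarrow> 'c::real_normed_vector) \<Rightarrow> bool" where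
  "bigO_on S f g \<longleftrightarrow> (\<forall>K. compact (closure K) \<and> closure K \<subseteq> S \<longrightarrow>
     (\<exists>C>0. \<forall>p\<in>K. norm (f p) \<le> C * norm (g p)))"

text \<open>\<open>L\<close> is quantified existentially: a nonvanishing \<open>L\<close> always exists after shrinking \<open>U\<close> and is
  unique on \<open>b\<Omega> \<inter> U\<close> up to a nonvanishing smooth factor, so its choice is immaterial; but a large
  \<open>U\<close> may admit none for topological reasons, and a universal quantifier would then be vacuous.\<close>

definition sesquiconvex_at :: "(complex^2) set \<Rightarrow> complex^2 \<Rightarrow> bool" where
  "sesquiconvex_at \<Omega> p0 \<longleftrightarrow> pseudoconvex_at \<Omega> p0 \<and>
     (\<exists>U \<rho> L. local_defining \<Omega> p0 U \<rho> \<and> holomorphic_tangential \<Omega> U \<rho> L \<and> (\<forall>p\<in>U. L p \<noteq> 0) \<and>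
        (let X = (\<lambda>p. re_part (L p)); Y = (\<lambda>p. im_part (L p)); T = (\<lambda>p. im_part (normal_10 \<rho> p))
         in bigO_on (frontier \<Omega> \<inter> U)
              (\<lambda>p. (real_hessian \<rho> p (Y p) (T p))\<^sup>2 + (real_hessian \<rho> p (X p) (T p))\<^sup>2)
              (\<lambda>p. complex_hessian \<rho> p (L p) (L p))))"

definition plurisubharmonic_on :: "(complex^2) set \<Rightarrow> (complex^2 \<Rightarrow> real) \<Rightarrow> bool" where
  "plurisubharmonic_on S \<rho> \<longleftrightarrow> (\<forall>q\<in>S. \<forall>A. 0 \<le> Re (complex_hessian \<rho> q A A))"

end

theory Submission
  imports Defs
begin

text \<open>Let \<open>\<delta>\<close> be the signed distance to the boundary, \<open>n\<close> its gradient, and \<open>T = J n\<close>. From \<open>\<bar>n\<bar> = 1\<close> the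
  real Hessian \<open>Q\<close> of \<open>\<delta>\<close> annihilates \<open>n\<close>, so on the boundary the mixed complex Hessian \<open>H(L, N)\<close> only
  involves \<open>Q(X, T)\<close> and \<open>Q(Y, T)\<close>, which do not depend on the defining function up to a factor; hence
  sesquiconvexity says \<open>\<bar>H(L, N)\<bar>\<^sup>2 \<le> K H(L, L)\<close>, and \<open>\<delta> + c \<delta>\<^sup>2 / 2\<close> has a nonnegative complex Hessian on the
  boundary for large \<open>c\<close>. Along inner normals \<open>Q\<close> solves a Riccati equation and therefore increases, while
  \<open>n\<close> is constant, so the estimate propagates from the boundary to the inside.

  Smoothness of \<open>\<delta>\<close> comes from inverting \<open>(x, s) \<mapsto> (x + s \<nabla>\<rho>(x), \<rho>(x))\<close>: the preimage of \<open>(q, 0)\<close>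
  has the foot point of \<open>q\<close> as its first component.\<close>

section \<open>Calculus of smooth functions\<close>


text \<open>A boundary estimate alone does not control nearby inner points: an error of order
  \<delta> in the tangential direction is not absorbed, because the term
  \<open>c / 2 * \<delta>\<^sup>2\<close> gains only in the complex normal direction. The signed
  distance is chosen because for it the change of the Hessian from the foot point to an inner point
  is positive semidefinite on all real vectors; adding the values at \<open>A\<close> and
  \<open>mult_i A\<close> carries this over to the complex Hessian. No differential equation is
  integrated: differentiating \<open>n (foot q) = n q\<close> already gives the solved form of the
  Riccati equation.

  Pseudoconvexity and the mixed estimate may come with different defining functions. Only X, Y and T
  enter, all of them real tangent to the boundary, and on such vectors the Hessians of two defining
  functions are proportional. In \<open>c = K + M\<close> the summand K pays for the mixed terms, M
  for the Hessian in direction T.\<close>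

lemma Ck_on_SucD:
  assumes "Ck_on (Suc k) U f"
  shows "Ck_on k U f"
  using assms
proof (induction k arbitrary: f)
  case 0
  then have "f differentiable_on U"
    by (simp add: differentiable_at_imp_differentiable_on)
  then show ?case by (simp add: differentiable_imp_continuous_on)
next
  case (Suc k)
  have prems: "\<forall>x\<in>U. f differentiable (at x)"
    "Ck_on (Suc k) U (\<lambda>x. frechet_derivative f (at x) v)" for v
    using iffD1[OF Ck_on.simps(2) Suc.prems] by blast+
  then show ?case unfolding Ck_on.simps(2)[of k U f] using Suc.IH by blast
qed

lemma Ck_on_subset: "Ck_on k U f \<Longrightarrow> V \<subseteq> U \<Longrightarrow> Ck_on k V f"
  by (induction k arbitrary: f) (auto intro: continuous_on_subset)

lemma frechet_derivative_cong_open: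
  assumes "open U" "\<And>x. x \<in> U \<Longrightarrow> f x = g x" "x \<in> U"
  shows "frechet_derivative f (at x) = frechet_derivative g (at x)"
proof -
  have "(f has_derivative D) (at x) \<longleftrightarrow> (g has_derivative D) (at x)" for D
    using has_derivative_transform_within_open[OF _ assms(1,3), of f D UNIV g]
      has_derivative_transform_within_open[OF _ assms(1,3), of g D UNIV f] assms(2) by auto
  then show ?thesis by (simp add: frechet_derivative_def)
qed

lemma Ck_on_cong:
  assumes "open U" "\<And>x. x \<in> U \<Longrightarrow> f x = g x" "Ck_on k U f"
  shows "Ck_on k U g"
  using assms
proof (induction k arbitrary: f g)
  case 0
  then show ?case using continuous_on_cong[of U U f g] by simp
next
  case (Suc k)
  have "g differentiable (at x)" if x: "x \<in> U" for x
  proof -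
    obtain D where "(f has_derivative D) (at x)"
      using iffD1[OF Ck_on.simps(2) Suc.prems(3)] x unfolding differentiable_def by blast
    then have "(g has_derivative D) (at x)"
      by (rule has_derivative_transform_within_open[OF _ Suc.prems(1) x Suc.prems(2)])
    then show ?thesis by (rule differentiableI)
  qed
  moreover have "Ck_on k U (\<lambda>x. frechet_derivative g (at x) v)" for v
  proof (rule Suc.IH[OF Suc.prems(1)])
    show "Ck_on k U (\<lambda>x. frechet_derivative f (at x) v)"
      using Suc.prems by simp
  qed (simp add: frechet_derivative_cong_open[OF Suc.prems(1,2)])
  ultimately show ?case unfolding Ck_on.simps(2)[of k U g] by simp
qed

text \<open>Replaces the choice hidden in \<open>frechet_derivative\<close> by an explicit formula
  for the derivative; the closure properties below are inductions on \<open>k\<close> through this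
  rule.\<close>

lemma Ck_on_SucI:
  assumes "open U" "\<And>x. x \<in> U \<Longrightarrow> (f has_derivative f' x) (at x)"
    and "\<And>v. Ck_on k U (\<lambda>x. f' x v)"
  shows "Ck_on (Suc k) U f"
proof -
  have "Ck_on k U (\<lambda>x. frechet_derivative f (at x) v)" for v
    by (rule Ck_on_cong[OF assms(1) _ assms(3)[of v]])
       (simp add: frechet_derivative_at[OF assms(2)])
  moreover have "\<forall>x\<in>U. f differentiable (at x)"
    using assms(2) differentiableI by blast
  ultimately show ?thesis unfolding Ck_on.simps(2)[of k U f] by simp
qed

lemma Ck_on_has_derivative:
  assumes "Ck_on (Suc k) U f" "x \<in> U"
  shows "(f has_derivative frechet_derivative f (at x)) (at x)"
  using assms by (simp add: frechet_derivative_works[symmetric])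

lemma Ck_on_const: "open U \<Longrightarrow> Ck_on k U (\<lambda>x. c)"
  by (induction k arbitrary: c) (auto intro!: Ck_on_SucI)

lemma Ck_on_bounded_linear:
  assumes "open U" "bounded_linear f"
  shows "Ck_on k U f"
proof (cases k)
  case 0
  then show ?thesis using assms linear_continuous_on by auto
next
  case (Suc n)
  then show ?thesis
    by (auto intro!: Ck_on_SucI[OF assms(1), of f "\<lambda>_. f"] Ck_on_const assms
        bounded_linear_imp_has_derivative simp del: Ck_on.simps)
qed

lemma Ck_on_linear_compose:
  assumes "open U" "bounded_linear h" "Ck_on k U f"
  shows "Ck_on k U (\<lambda>x. h (f x))"
  using assms(3)
proof (induction k arbitrary: f)
  case 0
  then show ?case using bounded_linear.continuous_on[OF assms(2)] by auto
next
  case (Suc k)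
  show ?case
    by (rule Ck_on_SucI[OF assms(1) bounded_linear.has_derivative[OF assms(2) Ck_on_has_derivative]])
       (use Suc in auto)
qed

lemma Ck_on_add:
  assumes "open U" "Ck_on k U f" "Ck_on k U g"
  shows "Ck_on k U (\<lambda>x. f x + g x)"
  using assms(2,3)
proof (induction k arbitrary: f g)
  case 0
  then show ?case by (auto intro: continuous_intros)
next
  case (Suc k)
  show ?case
    by (rule Ck_on_SucI[OF assms(1) has_derivative_add[OF Ck_on_has_derivative Ck_on_has_derivative]])
       (use Suc in auto)
qed

lemma Ck_on_sum:
  assumes "open U" "\<And>i. i \<in> I \<Longrightarrow> Ck_on k U (f i)"
  shows "Ck_on k U (\<lambda>x. \<Sum>i\<in>I. f i x)"
  using assms(2)
  by (induction I rule: infinite_finite_induct) (auto intro: Ck_on_const Ck_on_add assms(1))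

lemma Ck_on_bilinear:
  assumes "open U" "bounded_bilinear B" "Ck_on k U f" "Ck_on k U g"
  shows "Ck_on k U (\<lambda>x. B (f x) (g x))"
  using assms(3,4)
proof (induction k arbitrary: f g)
  case 0
  then show ?case using bounded_bilinear.continuous_on[OF assms(2)] by auto
next
  case (Suc k)
  have "Ck_on k U f" "Ck_on k U g" using Suc.prems by (auto intro: Ck_on_SucD simp del: Ck_on.simps)
  then show ?case
    by (intro Ck_on_SucI[OF assms(1) bounded_bilinear.FDERIV[OF assms(2) Ck_on_has_derivative Ck_on_has_derivative]])
       (use Suc in \<open>auto intro!: Ck_on_add assms(1)\<close>)
qed

lemma linear_basis_expansion:
  fixes f :: "'a::euclidean_space \<Rightarrow> 'b::real_normed_vector"
  assumes "linear f"
  shows "f v = (\<Sum>b\<in>Basis. (v \<bullet> b) *\<^sub>R f b)"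
proof -
  have "f v = f (\<Sum>b\<in>Basis. (v \<bullet> b) *\<^sub>R b)" by (simp add: euclidean_representation)
  also have "\<dots> = (\<Sum>b\<in>Basis. (v \<bullet> b) *\<^sub>R f b)"
    by (simp add: linear_sum[OF assms] linear_scale[OF assms])
  finally show ?thesis .
qed

lemma Ck_on_compose:
  fixes g :: "'a::real_normed_vector \<Rightarrow> 'b::euclidean_space"
  assumes "open U" "open V" "Ck_on k U f" "Ck_on k V g" "g ` V \<subseteq> U"
  shows "Ck_on k V (\<lambda>x. f (g x))"
  using assms(3,4)
proof (induction k arbitrary: f)
  case 0
  then show ?case using assms(5) continuous_on_compose2 by fastforce
next
  case (Suc k)
  \<comment> \<open>In the chain rule the outer derivative acts on a direction that varies with
    \<open>x\<close>, while \<open>Ck_on\<close> speaks of fixed directions. Expanding the direction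
    in the basis leaves only fixed ones, to which the induction hypothesis applies.\<close>
  let ?D = "\<lambda>x v. \<Sum>b\<in>Basis. (frechet_derivative g (at x) v \<bullet> b) *\<^sub>R frechet_derivative f (at (g x)) b"
  show ?case
  proof (rule Ck_on_SucI[OF assms(2)])
    fix x assume x: "x \<in> V"
    have f: "(f has_derivative frechet_derivative f (at (g x))) (at (g x))"
      and g: "(g has_derivative frechet_derivative g (at x)) (at x)"
      using Ck_on_has_derivative[OF Suc.prems(1)] Ck_on_has_derivative[OF Suc.prems(2)] x assms(5)
      by auto
    show "((\<lambda>x. f (g x)) has_derivative ?D x) (at x)"
      using has_derivative_compose[OF g f]
      by (subst (asm) linear_basis_expansion[OF has_derivative_linear[OF f]])
  next
    fix v
    have "Ck_on k V g" using Suc.prems(2) by (rule Ck_on_SucD)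
    then show "Ck_on k V (\<lambda>x. ?D x v)"
      using Suc by (intro Ck_on_sum Ck_on_bilinear[OF _ bounded_bilinear_scaleR]
          Ck_on_linear_compose[OF _ bounded_linear_inner_left] assms(2)) auto
  qed
qed

lemma smooth_on_const: "open U \<Longrightarrow> smooth_on U (\<lambda>x. c)"
  by (simp add: smooth_on_def Ck_on_const)

lemma smooth_on_bounded_linear: "open U \<Longrightarrow> bounded_linear f \<Longrightarrow> smooth_on U f"
  by (simp add: smooth_on_def Ck_on_bounded_linear)

lemma smooth_on_linear_compose:
  "open U \<Longrightarrow> bounded_linear h \<Longrightarrow> smooth_on U f \<Longrightarrow> smooth_on U (\<lambda>x. h (f x))"
  by (simp add: smooth_on_def Ck_on_linear_compose)

lemma smooth_on_add:
  "open U \<Longrightarrow> smooth_on U f \<Longrightarrow> smooth_on U g \<Longrightarrow> smooth_on U (\<lambda>x. f x + g x)"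
  by (simp add: smooth_on_def Ck_on_add)

lemma smooth_on_diff:
  "open U \<Longrightarrow> smooth_on U f \<Longrightarrow> smooth_on U g \<Longrightarrow> smooth_on U (\<lambda>x. f x - g x)"
  using smooth_on_add[of U f "\<lambda>x. - g x"]
    smooth_on_linear_compose[OF _ bounded_linear_minus[OF bounded_linear_ident], of U g] by simp

lemma smooth_on_sum:
  "open U \<Longrightarrow> (\<And>i. i \<in> I \<Longrightarrow> smooth_on U (f i)) \<Longrightarrow> smooth_on U (\<lambda>x. \<Sum>i\<in>I. f i x)"
  by (simp add: smooth_on_def Ck_on_sum)

lemma smooth_on_bilinear:
  "open U \<Longrightarrow> bounded_bilinear B \<Longrightarrow> smooth_on U f \<Longrightarrow> smooth_on U g
    \<Longrightarrow> smooth_on U (\<lambda>x. B (f x) (g x))"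
  by (simp add: smooth_on_def Ck_on_bilinear)

lemma smooth_on_compose:
  fixes g :: "'a::real_normed_vector \<Rightarrow> 'b::euclidean_space"
  shows "open U \<Longrightarrow> open V \<Longrightarrow> smooth_on U f \<Longrightarrow> smooth_on V g \<Longrightarrow> g ` V \<subseteq> U
    \<Longrightarrow> smooth_on V (\<lambda>x. f (g x))"
  by (simp add: smooth_on_def Ck_on_compose)

lemma smooth_on_subset: "smooth_on U f \<Longrightarrow> V \<subseteq> U \<Longrightarrow> smooth_on V f"
  unfolding smooth_on_def using Ck_on_subset[of _ U f V] by simp

lemma smooth_on_has_derivative:
  "smooth_on U f \<Longrightarrow> x \<in> U \<Longrightarrow> (f has_derivative frechet_derivative f (at x)) (at x)"
  unfolding smooth_on_def by (rule Ck_on_has_derivative) simp_all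

lemma smooth_on_linear_derivative:
  "smooth_on U f \<Longrightarrow> x \<in> U \<Longrightarrow> linear (frechet_derivative f (at x))"
  using smooth_on_has_derivative has_derivative_linear by blast

lemma smooth_on_continuous_on: "smooth_on U f \<Longrightarrow> continuous_on U f"
  unfolding smooth_on_def by (drule spec[of _ 0]) simp

lemma smooth_on_frechet_derivative:
  "smooth_on U f \<Longrightarrow> smooth_on U (\<lambda>x. frechet_derivative f (at x) v)"
proof (unfold smooth_on_def, intro allI)
  fix k
  assume "\<forall>k. Ck_on k U f"
  then have "Ck_on (Suc k) U f" ..
  then show "Ck_on k U (\<lambda>x. frechet_derivative f (at x) v)" by simp
qed

lemma smooth_on_Pair:
  assumes "open U" "smooth_on U f" "smooth_on U g"
  shows "smooth_on U (\<lambda>x. (f x, g x))"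
proof -
  have "bounded_linear (\<lambda>y::'b. (y, 0::'c))" "bounded_linear (\<lambda>y::'c. (0::'b, y))"
    by (auto intro!: bounded_linear_Pair bounded_linear_ident bounded_linear_zero)
  from smooth_on_add[OF assms(1) smooth_on_linear_compose[OF assms(1) this(1) assms(2)]
    smooth_on_linear_compose[OF assms(1) this(2) assms(3)]]
  show ?thesis by simp
qed

lemma smooth_on_powr: "smooth_on {0<..} (\<lambda>x::real. x powr a)"
proof -
  \<comment> \<open>The factor \<open>c\<close> and a free exponent are carried along because
    differentiation turns the function into another multiple of a power.\<close>
  have "Ck_on k {0<..} (\<lambda>x::real. c * x powr a)" for k c
  proof (induction k arbitrary: c a)
    case 0
    then show ?case by (auto intro!: continuous_intros)
  next
    case (Suc k)
    show ?case
    proof (rule Ck_on_SucI)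
      show "((\<lambda>x. c * x powr a) has_derivative (\<lambda>v. v * (c * (a * x powr (a - 1))))) (at x)"
        if "x \<in> {0<..}" for x
        using that by (auto intro!: derivative_eq_intros simp: powr_diff field_simps)
      show "Ck_on k {0<..} (\<lambda>x. v * (c * (a * x powr (a - 1))))" for v
        using Suc.IH[of "v * c * a" "a - 1"] by (simp add: mult.assoc)
    qed simp
  qed
  from this[of _ 1] show ?thesis by (simp add: smooth_on_def)
qed

text \<open>The inner product \<open>f x \<bullet> f x\<close> is smooth and positive, so powers of
  the norm need no derivative of the norm itself. The exponent -1 serves to normalise a
  gradient.\<close>

lemma smooth_on_norm_powr:
  fixes f :: "'a::real_normed_vector \<Rightarrow> 'b::euclidean_space"
  assumes "open U" "smooth_on U f" "\<And>x. x \<in> U \<Longrightarrow> f x \<noteq> 0"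
  shows "smooth_on U (\<lambda>x. norm (f x) powr a)"
proof -
  have "smooth_on U (\<lambda>x. (f x \<bullet> f x) powr (a / 2))"
    using assms
    by (intro smooth_on_compose[OF _ _ smooth_on_powr] smooth_on_bilinear[OF _ bounded_bilinear_inner])
       auto
  moreover have "(f x \<bullet> f x) powr (a / 2) = norm (f x) powr a" for x
  proof -
    have "f x \<bullet> f x = norm (f x) powr 2"
      by (simp add: power2_norm_eq_inner[symmetric])
    then show ?thesis by (simp only: powr_powr) simp
  qed
  ultimately show ?thesis by simp
qed

section \<open>Symmetry of second derivatives and the smooth inverse function theorem\<close>


lemma DERIV_along_line:
  fixes f :: "'a::real_normed_vector \<Rightarrow> real"
  assumes "(f has_derivative D) (at (a + s *\<^sub>R v))"
  shows "((\<lambda>s. f (a + s *\<^sub>R v)) has_real_derivative D v) (at s)"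
proof -
  have "((\<lambda>s. a + s *\<^sub>R v) has_derivative (\<lambda>h. h *\<^sub>R v)) (at s)"
    by (auto intro!: derivative_eq_intros)
  from has_derivative_compose[OF this assms] has_derivative_linear[OF assms]
  have "((\<lambda>s. f (a + s *\<^sub>R v)) has_derivative (\<lambda>h. h * D v)) (at s)"
    by (simp add: linear_scale)
  then show ?thesis
    by (simp add: has_field_derivative_def mult_commute_abs)
qed

text \<open>The mean value theorem is used twice: in direction \<open>v\<close> for the difference
  of two copies of \<open>f\<close> shifted by \<open>t *\<^sub>R w\<close>, then in direction
  \<open>w\<close> for the resulting derivative. The second difference is symmetric in
  \<open>v\<close> and \<open>w\<close>, whereas the right-hand side is not.\<close>

lemma mixed_difference_eq:
  fixes f :: "'a::real_normed_vector \<Rightarrow> real"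
  assumes f: "smooth_on U f" and U: "ball p r \<subseteq> U" and t: "0 < t" "t * (norm v + norm w) < r"
  obtains \<xi> where "dist \<xi> p \<le> t * (norm v + norm w)"
    "f (p + t *\<^sub>R v + t *\<^sub>R w) - f (p + t *\<^sub>R v) - f (p + t *\<^sub>R w) + f p =
     t * t * frechet_derivative (\<lambda>q. frechet_derivative f (at q) v) (at \<xi>) w"
proof -
  let ?D = "\<lambda>q. frechet_derivative f (at q)"
  have near: "norm (a *\<^sub>R v + b *\<^sub>R w) \<le> t * (norm v + norm w)"
    if "0 \<le> a" "a \<le> t" "0 \<le> b" "b \<le> t" for a b
  proof -
    have "norm (a *\<^sub>R v + b *\<^sub>R w) \<le> a * norm v + b * norm w"
      using norm_triangle_ineq[of "a *\<^sub>R v" "b *\<^sub>R w"] that by simp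
    also have "\<dots> \<le> t * norm v + t * norm w"
      using that by (intro add_mono mult_right_mono) auto
    finally show ?thesis by (simp add: distrib_left)
  qed
  have inU: "p + a *\<^sub>R v + b *\<^sub>R w \<in> U"
    if "0 \<le> a" "a \<le> t" "0 \<le> b" "b \<le> t" for a b
    using near[OF that] t(2) U by (auto simp: subset_iff dist_norm add.assoc norm_minus_commute)
  let ?\<phi> = "\<lambda>s. f (p + t *\<^sub>R w + s *\<^sub>R v) - f (p + s *\<^sub>R v)"
  have "DERIV ?\<phi> s :> ?D (p + t *\<^sub>R w + s *\<^sub>R v) v - ?D (p + s *\<^sub>R v) v" if "0 \<le> s" "s \<le> t" for s
    using that t inU[of s t] inU[of s 0]
    by (intro DERIV_diff DERIV_along_line smooth_on_has_derivative[OF f]) (auto simp: add_ac)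
  from MVT2[OF t(1) this] obtain z where z: "0 < z" "z < t"
    and eq1: "?\<phi> t - ?\<phi> 0 = (t - 0) * (?D (p + t *\<^sub>R w + z *\<^sub>R v) v - ?D (p + z *\<^sub>R v) v)" by blast
  let ?\<psi> = "\<lambda>s. ?D (p + z *\<^sub>R v + s *\<^sub>R w) v"
  have "DERIV ?\<psi> s :> frechet_derivative (\<lambda>q. ?D q v) (at (p + z *\<^sub>R v + s *\<^sub>R w)) w"
    if "0 \<le> s" "s \<le> t" for s
    using that z inU[of z s]
    by (intro DERIV_along_line[where f = "\<lambda>q. ?D q v"]
        smooth_on_has_derivative[OF smooth_on_frechet_derivative[OF f]]) auto
  from MVT2[OF t(1) this] obtain y where y: "0 < y" "y < t"
    and eq2: "?\<psi> t - ?\<psi> 0 =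
      (t - 0) * frechet_derivative (\<lambda>q. ?D q v) (at (p + z *\<^sub>R v + y *\<^sub>R w)) w" by blast
  show thesis
  proof (rule that)
    show "dist (p + z *\<^sub>R v + y *\<^sub>R w) p \<le> t * (norm v + norm w)"
      using near[of z y] z y by (simp add: dist_norm add.assoc)
    show "f (p + t *\<^sub>R v + t *\<^sub>R w) - f (p + t *\<^sub>R v) - f (p + t *\<^sub>R w) + f p =
      t * t * frechet_derivative (\<lambda>q. ?D q v) (at (p + z *\<^sub>R v + y *\<^sub>R w)) w"
      using eq1 eq2 by (simp add: add_ac)
  qed
qed

text \<open>Both orders of differentiation compute the same second difference, at two points that
  tend to \<open>p\<close> with \<open>t\<close>; continuity of the second derivatives does the
  rest.\<close>

lemma second_derivative_symmetric:
  fixes f :: "'a::real_normed_vector \<Rightarrow> real"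
  assumes U: "open U" and f: "smooth_on U f" and p: "p \<in> U"
  shows "frechet_derivative (\<lambda>q. frechet_derivative f (at q) v) (at p) w =
    frechet_derivative (\<lambda>q. frechet_derivative f (at q) w) (at p) v"
proof -
  let ?H = "\<lambda>v w q. frechet_derivative (\<lambda>q. frechet_derivative f (at q) v) (at q) w"
  obtain r where r: "r > 0" "ball p r \<subseteq> U" using U p openE by blast
  have cont: "isCont (?H v w) p" for v w
    using smooth_on_continuous_on[OF smooth_on_frechet_derivative[OF smooth_on_frechet_derivative[OF f]]]
      continuous_on_eq_continuous_at[OF U] p by blast
  have "\<bar>?H v w p - ?H w v p\<bar> \<le> 0 + 2 * e" if e: "e > 0" for e
  proof -
    obtain d1 where d1: "d1 > 0" "\<And>q. dist q p < d1 \<Longrightarrow> dist (?H v w q) (?H v w p) < e"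
      using cont[of v w] e unfolding continuous_at_eps_delta by blast
    obtain d2 where d2: "d2 > 0" "\<And>q. dist q p < d2 \<Longrightarrow> dist (?H w v q) (?H w v p) < e"
      using cont[of w v] e unfolding continuous_at_eps_delta by blast
    define N where "N = norm v + norm w"
    define m where "m = min r (min d1 d2)"
    \<comment> \<open>The summand 1 avoids a division by zero when both directions vanish, and makes
      \<open>t * N\<close> strictly smaller than \<open>m\<close>.\<close>
    define t where "t = m / (N + 1)"
    have N: "N \<ge> 0" and m: "m > 0" using r(1) d1(1) d2(1) by (auto simp: N_def m_def)
    have t: "t > 0" using N m by (simp add: t_def)
    have "t * N < t * (N + 1)" using t by simp
    also have "\<dots> = m" using N by (simp add: t_def)
    finally have tN: "t * N < m" .
    obtain \<xi> where \<xi>: "dist \<xi> p \<le> t * (norm v + norm w)"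
      "f (p + t *\<^sub>R v + t *\<^sub>R w) - f (p + t *\<^sub>R v) - f (p + t *\<^sub>R w) + f p = t * t * ?H v w \<xi>"
      using mixed_difference_eq[OF f r(2) t, of v w] tN by (auto simp: N_def m_def)
    obtain \<eta> where \<eta>: "dist \<eta> p \<le> t * (norm w + norm v)"
      "f (p + t *\<^sub>R w + t *\<^sub>R v) - f (p + t *\<^sub>R w) - f (p + t *\<^sub>R v) + f p = t * t * ?H w v \<eta>"
      using mixed_difference_eq[OF f r(2) t, of w v] tN by (auto simp: N_def m_def add.commute)
    have "t * t * ?H v w \<xi> = t * t * ?H w v \<eta>"
      using \<xi>(2)[unfolded add.assoc] \<eta>(2)[unfolded add.assoc add.commute[of "t *\<^sub>R w"]]
      by linarith
    then have "?H v w \<xi> = ?H w v \<eta>" using t by simp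
    moreover have "dist \<xi> p < d1" "dist \<eta> p < d2"
      using \<xi>(1) \<eta>(1) tN by (auto simp: N_def m_def add.commute)
    ultimately show ?thesis using d1(2)[of \<xi>] d2(2)[of \<eta>] by (simp add: dist_real_def)
  qed
  then have "\<bar>?H v w p - ?H w v p\<bar> \<le> 0 + e" if "e > 0" for e
    using that by (metis field_sum_of_halves half_gt_zero mult_2)
  then have "\<bar>?H v w p - ?H w v p\<bar> \<le> 0" by (rule field_le_epsilon)
  then show ?thesis by simp
qed

section \<open>Smooth dependence of inverse operators\<close>

lemma blinfun_inverse_difference:
  assumes "\<And>v. blinfun_apply A (blinfun_apply B v) = v" "\<And>v. blinfun_apply B' (blinfun_apply A' v) = v"
  shows "B' - B = B' o\<^sub>L ((A - A') o\<^sub>L B)"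
  by (rule blinfun_eqI) (simp add: blinfun.diff_left blinfun.diff_right assms)

context
  fixes V :: "'a::real_normed_vector set"
    and A :: "'a \<Rightarrow> 'b::real_normed_vector \<Rightarrow>\<^sub>L 'c::real_normed_vector" and B :: "'a \<Rightarrow> 'c \<Rightarrow>\<^sub>L 'b"
  assumes V: "open V"
    and AB: "\<And>y v. y \<in> V \<Longrightarrow> blinfun_apply (A y) (blinfun_apply (B y) v) = v"
    and BA: "\<And>y v. y \<in> V \<Longrightarrow> blinfun_apply (B y) (blinfun_apply (A y) v) = v"
begin

text \<open>Near \<open>y\<close> the resolvent identity bounds \<open>norm (B z - B y)\<close> by
  half of \<open>norm (B z)\<close>, so \<open>norm (B z)\<close> is at most twice
  \<open>norm (B y)\<close>. With this bound the identity makes the difference tend to 0 along with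
  \<open>A y - A z\<close>.\<close>

lemma isCont_blinfun_inverse:
  assumes y: "y \<in> V" and A: "isCont A y"
  shows "isCont B y"
proof -
  have A0: "((\<lambda>z. norm (A y - A z)) \<longlongrightarrow> 0) (at y)"
    using tendsto_norm[OF tendsto_diff[OF tendsto_const[of "A y"] A[unfolded isCont_def]]] by simp
  have "((\<lambda>z. norm (A y - A z) * norm (B y)) \<longlongrightarrow> 0) (at y)"
    using tendsto_mult_right[OF A0, of "norm (B y)"] by simp
  then have "\<forall>\<^sub>F z in at y. norm (A y - A z) * norm (B y) < 1 / 2"
    by (rule order_tendstoD) simp
  moreover have "\<forall>\<^sub>F z in at y. z \<in> V"
    using V y eventually_at_topological by blast
  ultimately have "\<forall>\<^sub>F z in at y. norm (B z - B y) \<le> norm (A y - A z) * (2 * norm (B y) * norm (B y))"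
  proof eventually_elim
    case (elim z)
    have "norm (B z - B y) \<le> norm (B z) * (norm (A y - A z) * norm (B y))"
      unfolding blinfun_inverse_difference[of "A y" "B y" "B z" "A z", OF AB[OF y] BA[OF elim(2)]]
      by (meson norm_blinfun_compose mult_left_mono norm_ge_zero order_trans)
    moreover have "norm (B z) * (norm (A y - A z) * norm (B y)) \<le> norm (B z) * (1 / 2)"
      using elim(1) by (intro mult_left_mono) auto
    moreover have "norm (B z) \<le> norm (B y) + norm (B z - B y)"
      using norm_triangle_sub by blast
    ultimately have "norm (B z) \<le> 2 * norm (B y)" by linarith
    then have "norm (B z) * (norm (A y - A z) * norm (B y))
      \<le> 2 * norm (B y) * (norm (A y - A z) * norm (B y))"
      by (intro mult_right_mono) auto
    with \<open>norm (B z - B y) \<le> norm (B z) * (norm (A y - A z) * norm (B y))\<close>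
    show ?case by (simp add: mult_ac)
  qed
  then have "((\<lambda>z. B z - B y) \<longlongrightarrow> 0) (at y)"
    by (intro tendsto_0_le[OF A0, where K = "2 * norm (B y) * norm (B y)"]) simp
  then show ?thesis by (simp add: isCont_def LIM_zero_iff)
qed

text \<open>The resolvent identity splits \<open>B z\<close> into \<open>B y\<close>, a part linear
  in \<open>A y - A z\<close>, and the remainder \<open>(B z - B y) o\<^sub>L ?C z\<close>. The
  remainder has derivative 0: its first factor tends to 0 by continuity, its second is of order
  \<open>norm (z - y)\<close>.\<close>

lemma has_derivative_blinfun_inverse:
  assumes y: "y \<in> V" and A: "(A has_derivative A') (at y)"
  shows "(B has_derivative (\<lambda>w. - (B y o\<^sub>L (A' w o\<^sub>L B y)))) (at y)"
proof -
  let ?C = "\<lambda>z. (A y - A z) o\<^sub>L B y"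
  let ?C' = "\<lambda>w. (- A' w) o\<^sub>L B y"
  note comp = bounded_bilinear_blinfun_compose
  have B: "isCont B y" using isCont_blinfun_inverse[OF y has_derivative_continuous[OF A]] .
  have C: "(?C has_derivative ?C') (at y)"
    using bounded_linear.has_derivative[OF bounded_bilinear.bounded_linear_left[OF comp]
        has_derivative_diff[OF has_derivative_const A]] by simp
  obtain M where M: "\<And>w. norm (?C' w) \<le> norm w * M"
    using bounded_linear.bounded[OF has_derivative_bounded_linear[OF C]] by blast
  have rem: "((\<lambda>z. (B z - B y) o\<^sub>L ?C z) has_derivative (\<lambda>w. 0)) (at y)"
    unfolding has_derivative_at_alt
  proof (intro conjI allI impI)
    fix e :: real assume e: "e > 0"
    obtain d1 where d1: "d1 > 0" "\<And>z. norm (z - y) < d1 \<Longrightarrow>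
        norm (?C z - ?C y - ?C' (z - y)) \<le> 1 * norm (z - y)"
      using C zero_less_one unfolding has_derivative_at_alt by blast
    define e' where "e' = e / (1 + \<bar>M\<bar>)"
    have e': "e' > 0" "e' * (1 + \<bar>M\<bar>) = e" using e by (auto simp: e'_def)
    obtain d2 where d2: "d2 > 0" "\<And>z. dist z y < d2 \<Longrightarrow> dist (B z) (B y) < e'"
      using B e'(1) unfolding continuous_at_eps_delta by blast
    have "norm (((B z - B y) o\<^sub>L ?C z) - ((B y - B y) o\<^sub>L ?C y) - 0) \<le> e * norm (z - y)"
      if z: "norm (z - y) < min d1 d2" for z
    proof -
      have "norm (?C z) \<le> norm (?C z - ?C' (z - y)) + norm (?C' (z - y))"
        by (metis diff_add_cancel norm_triangle_ineq)
      also have "\<dots> \<le> norm (z - y) + norm (z - y) * \<bar>M\<bar>"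
        using d1(2)[of z] z M[of "z - y"] mult_left_mono[OF abs_ge_self[of M], of "norm (z - y)"]
        by (simp add: bounded_bilinear.zero_left[OF comp])
      finally have "norm (?C z) \<le> (1 + \<bar>M\<bar>) * norm (z - y)" by (simp add: algebra_simps)
      moreover have "norm (B z - B y) \<le> e'" using d2(2)[of z] z by (simp add: dist_norm)
      ultimately have "norm (B z - B y) * norm (?C z) \<le> e' * ((1 + \<bar>M\<bar>) * norm (z - y))"
        using e' by (intro mult_mono) auto
      also have "\<dots> = e * norm (z - y)" using e'(2) by (simp add: mult.assoc[symmetric])
      finally show ?thesis
        using norm_blinfun_compose[of "B z - B y" "?C z"]
        by (simp add: bounded_bilinear.zero_left[OF comp])
    qed
    then show "\<exists>d>0. \<forall>z. norm (z - y) < d \<longrightarrow>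
        norm (((B z - B y) o\<^sub>L ?C z) - ((B y - B y) o\<^sub>L ?C y) - 0) \<le> e * norm (z - y)"
      using d1(1) d2(1) by (intro exI[of _ "min d1 d2"]) auto
  qed simp
  have "((\<lambda>z. B y + ((B y o\<^sub>L ?C z) + ((B z - B y) o\<^sub>L ?C z))) has_derivative
      (\<lambda>w. 0 + ((B y o\<^sub>L ?C' w) + 0))) (at y)"
    by (intro has_derivative_add has_derivative_const rem
        bounded_linear.has_derivative[OF bounded_bilinear.bounded_linear_right[OF comp] C])
  moreover have "B y + ((B y o\<^sub>L ?C z) + ((B z - B y) o\<^sub>L ?C z)) = B z" if "z \<in> V" for z
    using blinfun_inverse_difference[of "A y" "B y" "B z" "A z", OF AB[OF y] BA[OF that]]
    by (simp add: bounded_bilinear.diff_left[OF comp] algebra_simps)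
  ultimately have "(B has_derivative (\<lambda>w. 0 + ((B y o\<^sub>L ?C' w) + 0))) (at y)"
    using has_derivative_transform_within_open[OF _ V y] by blast
  then show ?thesis
    by (simp add: bounded_bilinear.minus_left[OF comp] bounded_bilinear.minus_right[OF comp])
qed

text \<open>The derivative of the inverse is a product of \<open>B\<close>, the derivative of
  \<open>A\<close> and \<open>B\<close> again, so each order of smoothness of \<open>B\<close>
  yields the next one as long as \<open>A\<close> allows it.\<close>

lemma Ck_on_blinfun_inverse: "Ck_on k V A \<Longrightarrow> Ck_on k V B"
proof (induction k)
  case 0
  then show ?case
    using isCont_blinfun_inverse by (simp add: continuous_on_eq_continuous_at V)
next
  case (Suc k)
  note comp = bounded_bilinear_blinfun_compose
  have B: "Ck_on k V B" using Suc.IH Ck_on_SucD[OF Suc.prems] .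
  show ?case
  proof (rule Ck_on_SucI[OF V has_derivative_blinfun_inverse[OF _ Ck_on_has_derivative[OF Suc.prems]]])
    have "Ck_on k V (\<lambda>x. frechet_derivative A (at x) v)" for v using Suc.prems by simp
    then show "Ck_on k V (\<lambda>x. - (B x o\<^sub>L (frechet_derivative A (at x) v o\<^sub>L B x)))" for v
      by (intro Ck_on_linear_compose[OF V bounded_linear_minus[OF bounded_linear_ident]]
          Ck_on_bilinear[OF V comp] B)
  qed
qed

end

text \<open>Bootstrapping: the derivative of \<open>g\<close> at \<open>y\<close> is the inverse of
  \<open>f' (g y)\<close>. If \<open>g\<close> is of class \<open>k\<close>, so is \<open>f'\<close>
  composed with \<open>g\<close>, hence so is its inverse, and \<open>g\<close> is of class
  \<open>Suc k\<close>.\<close>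

lemma smooth_inverse_function:
  fixes f :: "'a::euclidean_space \<Rightarrow> 'a"
  assumes U: "open U" "x0 \<in> U" and f: "smooth_on U f"
    and inj: "\<And>v. frechet_derivative f (at x0) v = 0 \<Longrightarrow> v = 0"
  obtains U' V g where "open U'" "U' \<subseteq> U" "x0 \<in> U'" "open V" "f x0 \<in> V"
    "homeomorphism U' V f g" "smooth_on V g"
proof -
  let ?D = "\<lambda>x. frechet_derivative f (at x)"
  \<comment> \<open>The operator-valued derivative is assembled from finitely many partial
    derivatives, so that its smoothness follows from that of derivatives in fixed
    directions.\<close>
  define f' where "f' = (\<lambda>x. \<Sum>b\<in>Basis. blinfun_scaleR_left (?D x b) o\<^sub>L blinfun_inner_left b)"
  have apply_f': "blinfun_apply (f' x) v = ?D x v" if "x \<in> U" for x v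
    using linear_basis_expansion[OF smooth_on_linear_derivative[OF f that], of v]
    by (simp add: f'_def blinfun.sum_left)
  have derf: "(f has_derivative blinfun_apply (f' x)) (at x)" if "x \<in> U" for x
  proof -
    have "blinfun_apply (f' x) = ?D x" using apply_f'[OF that] by blast
    then show ?thesis using smooth_on_has_derivative[OF f that] by simp
  qed
  have f'_smooth: "smooth_on U f'"
    unfolding f'_def
    by (intro smooth_on_sum smooth_on_bilinear[OF _ bounded_bilinear_blinfun_compose]
        smooth_on_linear_compose[OF _ bounded_linear_blinfun_scaleR_left]
        smooth_on_frechet_derivative smooth_on_const f U)
  obtain h where h: "linear h" "h \<circ> ?D x0 = id"
    using linear_injective_left_inverse[OF smooth_on_linear_derivative[OF f U(2)]]
      linear_injective_0[OF smooth_on_linear_derivative[OF f U(2)]] inj by blast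
  have "Blinfun h o\<^sub>L f' x0 = id_blinfun"
    using h apply_f'[OF U(2)]
    by (intro blinfun_eqI) (simp add: bounded_linear_Blinfun_apply linear_conv_bounded_linear pointfree_idE)
  from inverse_function_theorem[OF U(1) _ smooth_on_continuous_on[OF f'_smooth] U(2) this, of f]
  obtain U' V g g' where V: "open U'" "U' \<subseteq> U" "x0 \<in> U'" "open V" "f x0 \<in> V" "homeomorphism U' V f g"
    and g: "\<And>y. y \<in> V \<Longrightarrow> (g has_derivative (g' y)) (at y)"
    and g': "\<And>y. y \<in> V \<Longrightarrow> g' y = inv (blinfun_apply (f' (g y)))"
    and bij: "\<And>y. y \<in> V \<Longrightarrow> bij (blinfun_apply (f' (g y)))"
    using derf by blast
  have gV: "g ` V \<subseteq> U" using V(2,6) by (auto simp: homeomorphism_def)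
  define B where "B = (\<lambda>y. Blinfun (g' y))"
  have B: "blinfun_apply (B y) = g' y" if "y \<in> V" for y
    using has_derivative_bounded_linear[OF g[OF that]] by (simp add: B_def bounded_linear_Blinfun_apply)
  have "Ck_on k V g" for k
  proof (induction k)
    case 0
    then show ?case using V(6) by (simp add: homeomorphism_def)
  next
    case (Suc k)
    have "Ck_on k V (\<lambda>y. f' (g y))"
      using f'_smooth by (intro Ck_on_compose[OF U(1) V(4) _ Suc gV]) (simp add: smooth_on_def)
    then have "Ck_on k V B"
    proof (rule Ck_on_blinfun_inverse[OF V(4), rotated 2])
      show "blinfun_apply (f' (g y)) (blinfun_apply (B y) v) = v" if "y \<in> V" for y v
        using bij[OF that] by (simp add: B[OF that] g'[OF that] bij_is_surj surj_f_inv_f)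
      show "blinfun_apply (B y) (blinfun_apply (f' (g y)) v) = v" if "y \<in> V" for y v
        using bij[OF that] by (simp add: B[OF that] g'[OF that] bij_is_inj)
    qed
    from Ck_on_bilinear[OF V(4) bounded_bilinear_blinfun_apply this Ck_on_const[OF V(4)]]
    have "Ck_on k V (\<lambda>y. blinfun_apply (B y) v)" for v .
    then have "Ck_on k V (\<lambda>y. g' y v)" for v
      by (rule Ck_on_cong[OF V(4), rotated]) (simp add: B)
    with g show ?case by (rule Ck_on_SucI[OF V(4)])
  qed
  then have "smooth_on V g" by (simp add: smooth_on_def)
  with V show thesis by (rule that)
qed

section \<open>Gradients and signed distance functions\<close>


definition grad :: "('a::euclidean_space \<Rightarrow> real) \<Rightarrow> 'a \<Rightarrow> 'a" where
  "grad f q = (\<Sum>b\<in>Basis. frechet_derivative f (at q) b *\<^sub>R b)"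

lemma grad_inner:
  assumes "f differentiable (at q)"
  shows "grad f q \<bullet> v = frechet_derivative f (at q) v"
  unfolding linear_basis_expansion[OF linear_frechet_derivative[OF assms], of v]
  by (simp add: grad_def inner_sum_left inner_commute[of v] mult.commute)

lemma smooth_on_differentiable: "smooth_on U f \<Longrightarrow> q \<in> U \<Longrightarrow> f differentiable (at q)"
  using smooth_on_has_derivative differentiableI by blast

lemma grad_eqI:
  assumes "(f has_derivative (\<lambda>v. g \<bullet> v)) (at q)"
  shows "grad f q = g"
  by (rule vector_eq_rdot[THEN iffD1])
     (simp add: grad_inner[OF differentiableI[OF assms]] frechet_derivative_at[OF assms, symmetric])

lemma smooth_on_grad: "open U \<Longrightarrow> smooth_on U f \<Longrightarrow> smooth_on U (grad f)"
  unfolding grad_def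
  by (intro smooth_on_sum smooth_on_bilinear[OF _ bounded_bilinear_scaleR]
      smooth_on_frechet_derivative smooth_on_const)

lemma frechet_derivative_inner_left:
  assumes "f differentiable (at q)"
  shows "frechet_derivative (\<lambda>q. f q \<bullet> v) (at q) w = frechet_derivative f (at q) w \<bullet> v"
  by (rule fun_cong[OF frechet_derivative_at[OF has_derivative_inner_left[OF
      assms[unfolded frechet_derivative_works]]], symmetric])

lemma grad_derivative_inner:
  assumes "open U" "smooth_on U f" "q \<in> U"
  shows "frechet_derivative (grad f) (at q) w \<bullet> v =
    frechet_derivative (\<lambda>q. frechet_derivative f (at q) v) (at q) w"
proof -
  have "frechet_derivative (grad f) (at q) w \<bullet> v = frechet_derivative (\<lambda>q. grad f q \<bullet> v) (at q) w"
    by (rule frechet_derivative_inner_left[symmetric])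
       (rule smooth_on_differentiable[OF smooth_on_grad[OF assms(1,2)] assms(3)])
  also have "frechet_derivative (\<lambda>q. grad f q \<bullet> v) (at q) =
      frechet_derivative (\<lambda>q. frechet_derivative f (at q) v) (at q)"
    by (rule frechet_derivative_cong_open[OF assms(1) _ assms(3)])
       (rule grad_inner[OF smooth_on_differentiable[OF assms(2)]])
  finally show ?thesis .
qed

lemma grad_derivative_symmetric:
  assumes "open U" "smooth_on U f" "q \<in> U"
  shows "frechet_derivative (grad f) (at q) w \<bullet> v = frechet_derivative (grad f) (at q) v \<bullet> w"
  using grad_derivative_inner[OF assms] second_derivative_symmetric[OF assms] by simp

text \<open>The axioms describe a signed distance without nearest points: \<open>n\<close> is the
  unit gradient, and \<open>q - \<delta> q *\<^sub>R n q\<close> plays the role of the nearest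
  boundary point. The two foot axioms are conditional because \<open>W\<close> need not contain the
  foot points of its elements.\<close>

locale signed_distance =
  fixes W :: "'a::euclidean_space set" and \<delta> :: "'a \<Rightarrow> real" and n :: "'a \<Rightarrow> 'a"
  assumes open_W: "open W"
    and smooth_delta: "smooth_on W \<delta>"
    and smooth_n: "smooth_on W n"
    and delta_derivative: "\<And>q. q \<in> W \<Longrightarrow> (\<delta> has_derivative (\<lambda>v. n q \<bullet> v)) (at q)"
    and norm_n: "\<And>q. q \<in> W \<Longrightarrow> norm (n q) = 1"
    and n_foot: "\<And>q. q \<in> W \<Longrightarrow> q - \<delta> q *\<^sub>R n q \<in> W \<Longrightarrow> n (q - \<delta> q *\<^sub>R n q) = n q"
    and delta_foot: "\<And>q. q \<in> W \<Longrightarrow> q - \<delta> q *\<^sub>R n q \<in> W \<Longrightarrow> \<delta> (q - \<delta> q *\<^sub>R n q) = 0"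
begin

abbreviation foot :: "'a \<Rightarrow> 'a" where "foot q \<equiv> q - \<delta> q *\<^sub>R n q"

abbreviation Dn :: "'a \<Rightarrow> 'a \<Rightarrow> 'a" where "Dn q \<equiv> frechet_derivative n (at q)"

lemma n_derivative: "q \<in> W \<Longrightarrow> (n has_derivative Dn q) (at q)"
  using smooth_on_has_derivative[OF smooth_n] .

lemma grad_delta: "q \<in> W \<Longrightarrow> grad \<delta> q = n q"
  using grad_eqI[OF delta_derivative] .

lemma Dn_linear: "q \<in> W \<Longrightarrow> linear (Dn q)"
  using has_derivative_linear[OF n_derivative] .

lemma Dn_eq_grad: "q \<in> W \<Longrightarrow> Dn q = frechet_derivative (grad \<delta>) (at q)"
  by (rule frechet_derivative_cong_open[OF open_W grad_delta, symmetric])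

lemma Dn_symmetric: "q \<in> W \<Longrightarrow> Dn q v \<bullet> w = Dn q w \<bullet> v"
  using grad_derivative_symmetric[OF open_W smooth_delta] by (simp add: Dn_eq_grad)

lemma Dn_inner_n:
  assumes q: "q \<in> W"
  shows "Dn q v \<bullet> n q = 0"
proof -
  have "((\<lambda>q. n q \<bullet> n q) has_derivative (\<lambda>v. n q \<bullet> Dn q v + Dn q v \<bullet> n q)) (at q)"
    by (rule has_derivative_inner[OF n_derivative[OF q] n_derivative[OF q]])
  moreover have "((\<lambda>q. n q \<bullet> n q) has_derivative (\<lambda>v. 0)) (at q)"
    by (rule has_derivative_transform_within_open[OF has_derivative_const[of 1] open_W q])
       (simp add: dot_square_norm norm_n)
  ultimately have "(\<lambda>v. n q \<bullet> Dn q v + Dn q v \<bullet> n q) = (\<lambda>v. 0)"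
    by (rule has_derivative_unique)
  from fun_cong[OF this, of v] show ?thesis by (simp add: inner_commute)
qed

lemma Dn_n:
  assumes "q \<in> W"
  shows "Dn q (n q) = 0"
  using Dn_symmetric[OF assms, of "n q" "Dn q (n q)"] Dn_inner_n[OF assms] by simp

lemma foot_derivative:
  assumes "q \<in> W"
  shows "(foot has_derivative (\<lambda>v. v - ((n q \<bullet> v) *\<^sub>R n q + \<delta> q *\<^sub>R Dn q v))) (at q)"
proof -
  have "((\<lambda>q. \<delta> q *\<^sub>R n q) has_derivative (\<lambda>v. \<delta> q *\<^sub>R Dn q v + (n q \<bullet> v) *\<^sub>R n q)) (at q)"
    by (rule has_derivative_scaleR[OF delta_derivative[OF assms] n_derivative[OF assms]])
  then have "((\<lambda>q. \<delta> q *\<^sub>R n q) has_derivative (\<lambda>v. (n q \<bullet> v) *\<^sub>R n q + \<delta> q *\<^sub>R Dn q v)) (at q)"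
    by (simp add: add.commute)
  then show ?thesis by (rule has_derivative_diff[OF has_derivative_ident])
qed

lemma open_foot_vimage:
  assumes "open S"
  shows "open {q \<in> W. foot q \<in> S}"
proof -
  have "continuous_on W foot"
    using foot_derivative has_derivative_continuous continuous_at_imp_continuous_on by blast
  then show ?thesis
    using continuous_open_preimage[OF _ open_W assms, of foot] by (simp add: vimage_def Int_def)
qed

text \<open>Differentiate \<open>n (foot q) = n q\<close>, which holds on an open set. The component
  of the derivative of the foot map along \<open>n q\<close> disappears, since \<open>n q\<close> is
  also the normal at the foot point and lies in the kernel of the Hessian there.\<close>

lemma Dn_foot:
  assumes q: "q \<in> W" "foot q \<in> W"
  shows "Dn q v = Dn (foot q) v - \<delta> q *\<^sub>R Dn (foot q) (Dn q v)"
proof -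
  have "((\<lambda>q. n (foot q)) has_derivative (\<lambda>v. Dn (foot q) (v - ((n q \<bullet> v) *\<^sub>R n q + \<delta> q *\<^sub>R Dn q v)))) (at q)"
    by (rule has_derivative_compose[OF foot_derivative[OF q(1)] n_derivative[OF q(2)]])
  then have "(n has_derivative (\<lambda>v. Dn (foot q) (v - ((n q \<bullet> v) *\<^sub>R n q + \<delta> q *\<^sub>R Dn q v)))) (at q)"
    by (rule has_derivative_transform_within_open[OF _ open_foot_vimage[OF open_W]])
       (use q n_foot in auto)
  from fun_cong[OF has_derivative_unique[OF n_derivative[OF q(1)] this], of v]
  have "Dn q v = Dn (foot q) (v - ((n q \<bullet> v) *\<^sub>R n q + \<delta> q *\<^sub>R Dn q v))" .
  also have "\<dots> = Dn (foot q) v - ((n q \<bullet> v) *\<^sub>R Dn (foot q) (n q) + \<delta> q *\<^sub>R Dn (foot q) (Dn q v))"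
    using Dn_linear[OF q(2)] by (simp add: linear_diff linear_add linear_scale)
  also have "Dn (foot q) (n q) = 0"
    using Dn_n[OF q(2)] n_foot[OF q] by simp
  finally show ?thesis unfolding scaleR_zero_right add_0_left .
qed

text \<open>With \<open>H = Dn q\<close>, \<open>K = Dn (foot q)\<close> and \<open>t = - \<delta> q\<close> the previous lemma reads \<open>H = K + t K H\<close>,
  so \<open>H - K = t K H = t (H - t K H) H = t (H\<^sup>2 - t H K H)\<close>.\<close>

lemma Dn_foot_le:
  assumes q: "q \<in> W" "foot q \<in> W" "\<delta> q \<le> 0"
    and M: "\<And>v. norm (Dn (foot q) v) \<le> M * norm v" "- \<delta> q * M \<le> 1"
  shows "Dn (foot q) v \<bullet> v \<le> Dn q v \<bullet> v"
proof -
  let ?H = "Dn q v" and ?K = "Dn (foot q)"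
  have Kv: "?H + \<delta> q *\<^sub>R ?K ?H = ?K v"
    by (rule Dn_foot[OF q(1,2), unfolded eq_diff_eq])
  have "\<bar>?K ?H \<bullet> ?H\<bar> \<le> norm (?K ?H) * norm ?H" by (rule Cauchy_Schwarz_ineq2)
  also have "\<dots> \<le> M * norm ?H * norm ?H" by (intro mult_right_mono M) simp
  finally have "- \<delta> q * (?K ?H \<bullet> ?H) \<le> - \<delta> q * (M * norm ?H * norm ?H)"
    using q(3) by (intro mult_left_mono) auto
  also have "\<dots> = - \<delta> q * M * (norm ?H)\<^sup>2" by (simp add: power2_eq_square)
  also have "\<dots> \<le> 1 * (norm ?H)\<^sup>2" by (intro mult_right_mono M) simp
  finally have "0 \<le> - \<delta> q * (?H \<bullet> ?H + \<delta> q * (?K ?H \<bullet> ?H))"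
    using q(3) by (intro mult_nonneg_nonneg) (simp_all add: power2_norm_eq_inner)
  also have "?H \<bullet> ?H + \<delta> q * (?K ?H \<bullet> ?H) = ?K v \<bullet> ?H"
    by (simp add: Kv[symmetric] inner_add_left)
  also have "- \<delta> q * (?K v \<bullet> ?H) = (- \<delta> q *\<^sub>R ?K ?H) \<bullet> v"
    using Dn_symmetric[OF q(2), of v ?H] by simp
  also have "\<dots> = (?H - ?K v) \<bullet> v" by (simp add: Kv[symmetric])
  finally show ?thesis by (simp add: inner_diff_left)
qed

section \<open>Comparison of the distance with other functions vanishing on the boundary\<close>

context
  fixes r :: "'a \<Rightarrow> real" and U
  assumes U: "open U" and r: "smooth_on U r"
    and r0: "\<And>q. q \<in> W \<Longrightarrow> q \<in> U \<Longrightarrow> \<delta> q = 0 \<Longrightarrow> r q = 0"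
begin

text \<open>The composition of \<open>r\<close> with the foot map vanishes near \<open>p\<close>,
  and at a boundary point the derivative of the foot map is the orthogonal projection onto the
  complement of \<open>n p\<close>.\<close>

lemma grad_parallel_n:
  assumes p: "p \<in> W" "p \<in> U" "\<delta> p = 0"
  shows "grad r p = (grad r p \<bullet> n p) *\<^sub>R n p"
proof -
  have "(r has_derivative frechet_derivative r (at p)) (at (foot p))"
    using smooth_on_has_derivative[OF r p(2)] p(3) by simp
  from has_derivative_compose[OF foot_derivative[OF p(1)] this]
  have "((\<lambda>q. r (foot q)) has_derivative (\<lambda>v. grad r p \<bullet> (v - (n p \<bullet> v) *\<^sub>R n p))) (at p)"
    using p(3) by (simp add: grad_inner[OF smooth_on_differentiable[OF r p(2)]])
  moreover have "((\<lambda>q. r (foot q)) has_derivative (\<lambda>v. 0)) (at p)"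
    by (rule has_derivative_transform_within_open[OF has_derivative_const[of 0]
          open_foot_vimage[OF open_Int[OF open_W U]]])
       (use p in \<open>auto simp: r0 delta_foot\<close>)
  ultimately have "(\<lambda>v. grad r p \<bullet> (v - (n p \<bullet> v) *\<^sub>R n p)) = (\<lambda>v. 0)"
    by (rule has_derivative_unique)
  then have "grad r p \<bullet> v = ((grad r p \<bullet> n p) *\<^sub>R n p) \<bullet> v" for v
    by (drule_tac fun_cong[where x = v]) (simp add: inner_diff_right mult.commute)
  then have "\<forall>v. grad r p \<bullet> v = ((grad r p \<bullet> n p) *\<^sub>R n p) \<bullet> v" ..
  then show ?thesis by (rule vector_eq_rdot[THEN iffD1])
qed

text \<open>Composing with the foot map turns the boundary identity of
  \<open>grad_parallel_n\<close> into one valid on an open set, which can be differentiated without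
  boundary curves. The derivative of the scalar coefficient multiplies \<open>n p\<close> and is
  killed by pairing with the tangential \<open>w\<close>.\<close>

lemma tangential_hessian:
  assumes p: "p \<in> W" "p \<in> U" "\<delta> p = 0" and v: "v \<bullet> n p = 0" and w: "w \<bullet> n p = 0"
  shows "frechet_derivative (grad r) (at p) v \<bullet> w = (grad r p \<bullet> n p) * (Dn p v \<bullet> w)"
proof -
  let ?G = "frechet_derivative (grad r) (at p)"
  let ?F = "\<lambda>v. v - ((n p \<bullet> v) *\<^sub>R n p + \<delta> p *\<^sub>R Dn p v)"
  have G: "(grad r has_derivative ?G) (at (foot p))"
    using smooth_on_has_derivative[OF smooth_on_grad[OF U r] p(2)] p(3) by simp
  have *: "((\<lambda>q. grad r (foot q)) has_derivative (\<lambda>v. ?G (?F v))) (at p)"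
    by (rule has_derivative_compose[OF foot_derivative[OF p(1)] G])
  define D where "D = (\<lambda>v. grad r (foot p) \<bullet> Dn p v + ?G (?F v) \<bullet> n p)"
  have "((\<lambda>q. (grad r (foot q) \<bullet> n q) *\<^sub>R n q) has_derivative
      (\<lambda>v. (grad r (foot p) \<bullet> n p) *\<^sub>R Dn p v + D v *\<^sub>R n p)) (at p)"
    unfolding D_def
    by (rule has_derivative_scaleR[OF has_derivative_inner[OF * n_derivative[OF p(1)]] n_derivative[OF p(1)]])
  then have "((\<lambda>q. grad r (foot q)) has_derivative
      (\<lambda>v. (grad r (foot p) \<bullet> n p) *\<^sub>R Dn p v + D v *\<^sub>R n p)) (at p)"
  proof (rule has_derivative_transform_within_open[OF _ open_foot_vimage[OF open_Int[OF open_W U]]])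
    show "(grad r (foot q) \<bullet> n q) *\<^sub>R n q = grad r (foot q)" if "q \<in> {q \<in> W. foot q \<in> W \<inter> U}" for q
      using grad_parallel_n[of "foot q"] that by (simp add: n_foot delta_foot)
  qed (use p in auto)
  from fun_cong[OF has_derivative_unique[OF * this], of v]
  have "?G v = (grad r p \<bullet> n p) *\<^sub>R Dn p v + D v *\<^sub>R n p"
    using p(3) v by (simp add: inner_commute)
  then show ?thesis using w by (simp add: inner_add_left inner_commute[of "n p" w])
qed

end

end

section \<open>Existence of the signed distance\<close>


lemma signed_distance_exists:
  fixes \<rho> :: "'a::euclidean_space \<Rightarrow> real"
  assumes U: "open U" "p0 \<in> U" and \<rho>: "smooth_on U \<rho>" and \<rho>0: "\<rho> p0 = 0"
    and nonsing: "grad \<rho> p0 \<noteq> 0"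
  obtains W \<delta> n where "signed_distance W \<delta> n" "p0 \<in> W" "W \<subseteq> U"
    "\<And>q. q \<in> W \<Longrightarrow> \<delta> q < 0 \<longleftrightarrow> \<rho> q < 0" "\<And>q. q \<in> W \<Longrightarrow> \<delta> q = 0 \<longleftrightarrow> \<rho> q = 0"
proof -
  let ?G = "grad \<rho>"
  have G_U: "smooth_on U ?G" by (rule smooth_on_grad[OF U(1) \<rho>])
  define U0 where "U0 = {q \<in> U. ?G q \<noteq> 0}"
  have U0: "open U0" "p0 \<in> U0" "U0 \<subseteq> U"
    using continuous_open_preimage[OF smooth_on_continuous_on[OF G_U] U(1), of "- {0}"] U(2) nonsing
    by (auto simp: U0_def vimage_def Int_def)
  have G_nz: "?G q \<noteq> 0" if "q \<in> U0" for q using that by (simp add: U0_def)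
  have \<rho>_U0: "smooth_on U0 \<rho>" and G: "smooth_on U0 ?G"
    using smooth_on_subset \<rho> G_U U0(3) by blast+
  have \<rho>_deriv: "(\<rho> has_derivative (\<lambda>v. ?G q \<bullet> v)) (at q)" if "q \<in> U0" for q
    using smooth_on_has_derivative[OF \<rho>_U0 that] grad_inner[OF smooth_on_differentiable[OF \<rho>_U0 that]]
    by simp
  let ?\<Phi> = "\<lambda>z::'a \<times> real. (fst z + snd z *\<^sub>R ?G (fst z), \<rho> (fst z))"
  have open_prod: "open (U0 \<times> (UNIV :: real set))" using U0(1) by (simp add: open_Times)
  have \<Phi>: "smooth_on (U0 \<times> UNIV) ?\<Phi>"
    by (intro smooth_on_Pair smooth_on_add smooth_on_bilinear[OF _ bounded_bilinear_scaleR]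
        smooth_on_bounded_linear smooth_on_compose[OF U0(1) _ G] smooth_on_compose[OF U0(1) _ \<rho>_U0]
        open_prod bounded_linear_fst bounded_linear_snd) auto
  have D\<Phi>: "frechet_derivative ?\<Phi> (at (p0, 0)) = (\<lambda>z. (fst z + snd z *\<^sub>R ?G p0, ?G p0 \<bullet> fst z))"
  proof (rule frechet_derivative_at[symmetric])
    have G': "(?G has_derivative frechet_derivative ?G (at p0)) (at (fst (p0, 0::real)))"
      and \<rho>': "(\<rho> has_derivative (\<lambda>v. ?G p0 \<bullet> v)) (at (fst (p0, 0::real)))"
      using smooth_on_has_derivative[OF G U0(2)] \<rho>_deriv[OF U0(2)] by simp_all
    have f: "(fst has_derivative fst) (at (p0, 0::real))" and s: "(snd has_derivative snd) (at (p0, 0::real))"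
      by (rule bounded_linear_imp_has_derivative[OF bounded_linear_fst]
          bounded_linear_imp_has_derivative[OF bounded_linear_snd])+
    show "(?\<Phi> has_derivative (\<lambda>z. (fst z + snd z *\<^sub>R ?G p0, ?G p0 \<bullet> fst z))) (at (p0, 0))"
      using has_derivative_Pair[OF has_derivative_add[OF f has_derivative_scaleR[OF s has_derivative_compose[OF f G']]]
          has_derivative_compose[OF f \<rho>']] by simp
  qed
  have inj: "z = 0" if "frechet_derivative ?\<Phi> (at (p0, 0)) z = 0" for z
  proof -
    from that have eq: "fst z = - (snd z *\<^sub>R ?G p0)" and "?G p0 \<bullet> fst z = 0"
      unfolding D\<Phi> by (simp_all add: prod_eq_iff eq_neg_iff_add_eq_0)
    then have "snd z * (?G p0 \<bullet> ?G p0) = 0" by simp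
    then have "snd z = 0" using nonsing by simp
    with eq show ?thesis by (simp add: prod_eq_iff)
  qed
  obtain U' V g where U': "open U'" "U' \<subseteq> U0 \<times> UNIV" "(p0, 0) \<in> U'"
    and V: "open V" "?\<Phi> (p0, 0) \<in> V" and hom: "homeomorphism U' V ?\<Phi> g" and g: "smooth_on V g"
    using smooth_inverse_function[OF open_prod _ \<Phi> inj] U0(2) by blast
  \<comment> \<open>Membership in \<open>V\<close> makes the foot point available through
    \<open>g\<close>. Membership in \<open>U'\<close> makes \<open>g\<close> undo
    \<open>?\<Phi>\<close> at \<open>(q, 0)\<close>, so that boundary points are their own
    feet.\<close>
  define W0 where "W0 = {q. (q, 0::real) \<in> V \<inter> U'}"
  have W0: "open W0" "p0 \<in> W0"
  proof -
    have "continuous_on UNIV (\<lambda>q::'a. (q, 0::real))" by (intro continuous_intros)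
    from open_vimage[OF open_Int[OF V(1) U'(1)] this] show "open W0"
      by (simp add: W0_def vimage_def)
    show "p0 \<in> W0" using V(2) U'(3) \<rho>0 by (simp add: W0_def)
  qed
  define x where "x = (\<lambda>q. fst (g (q, 0)))"
  define s where "s = (\<lambda>q. snd (g (q, 0)))"
  define n where "n = (\<lambda>q. (norm (?G (x q)) powr - 1) *\<^sub>R ?G (x q))"
  define \<delta> where "\<delta> = (\<lambda>q. (q - x q) \<bullet> n q)"
  have x_U0: "x q \<in> U0" and decomp: "q = x q + s q *\<^sub>R ?G (x q)" and \<rho>_x: "\<rho> (x q) = 0"
    if "q \<in> W0" for q
  proof -
    have "g (q, 0) \<in> U'" "?\<Phi> (g (q, 0)) = (q, 0)"
      using hom that by (auto simp: homeomorphism_def W0_def)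
    then show "x q \<in> U0" "q = x q + s q *\<^sub>R ?G (x q)" "\<rho> (x q) = 0"
      using U'(2) by (auto simp: x_def s_def mem_Times_iff)
  qed
  have x_boundary: "x q = q" if "q \<in> W0" "\<rho> q = 0" for q
  proof -
    have "g (?\<Phi> (q, 0)) = (q, 0)"
      using hom that by (auto simp: homeomorphism_def W0_def)
    then show ?thesis using that by (simp add: x_def)
  qed
  have n_powr: "n q = (1 / norm (?G (x q))) *\<^sub>R ?G (x q)" if "q \<in> W0" for q
    using G_nz[OF x_U0[OF that]] by (simp add: n_def powr_minus divide_inverse)
  have norm_n: "norm (n q) = 1" if "q \<in> W0" for q
    using G_nz[OF x_U0[OF that]] by (simp add: n_powr[OF that])
  have \<delta>_s: "\<delta> q = s q * norm (?G (x q))" if "q \<in> W0" for q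
  proof -
    have "\<delta> q = (s q *\<^sub>R ?G (x q)) \<bullet> n q"
      unfolding \<delta>_def using decomp[OF that] by (metis add_diff_cancel_left')
    then show ?thesis
      using G_nz[OF x_U0[OF that]] by (simp add: n_powr[OF that] dot_square_norm power2_eq_square)
  qed
  have \<delta>_n: "\<delta> q *\<^sub>R n q = q - x q" if "q \<in> W0" for q
  proof -
    have "\<delta> q *\<^sub>R n q = s q *\<^sub>R ?G (x q)"
      using G_nz[OF x_U0[OF that]] by (simp add: n_powr[OF that] \<delta>_s[OF that])
    then show ?thesis using decomp[OF that] by (metis add_diff_cancel_left')
  qed
  have foot: "q - \<delta> q *\<^sub>R n q = x q" if "q \<in> W0" for q
    using \<delta>_n[OF that] by simp
  have smooth_g0: "smooth_on W0 (\<lambda>q. g (q, 0))"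
    by (rule smooth_on_compose[OF V(1) W0(1) g smooth_on_Pair[OF W0(1) smooth_on_bounded_linear smooth_on_const]])
       (use W0 in \<open>auto simp: W0_def bounded_linear_ident\<close>)
  have smooth_x: "smooth_on W0 x"
    unfolding x_def by (rule smooth_on_linear_compose[OF W0(1) bounded_linear_fst smooth_g0])
  have xW0: "x ` W0 \<subseteq> U0" using x_U0 by blast
  have smooth_n: "smooth_on W0 n"
    unfolding n_def
    by (intro smooth_on_bilinear[OF W0(1) bounded_bilinear_scaleR] smooth_on_norm_powr
        smooth_on_compose[OF U0(1) W0(1) G smooth_x xW0] W0(1) G_nz x_U0)
  have smooth_\<delta>: "smooth_on W0 \<delta>"
    unfolding \<delta>_def
    by (intro smooth_on_bilinear[OF W0(1) bounded_bilinear_inner] smooth_on_diff smooth_on_bounded_linear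
        bounded_linear_ident smooth_n smooth_x W0(1))
  have \<delta>_deriv: "(\<delta> has_derivative (\<lambda>v. n q \<bullet> v)) (at q)" if q: "q \<in> W0" for q
  proof -
    let ?x' = "frechet_derivative x (at q)" and ?n' = "frechet_derivative n (at q)"
    have x': "(x has_derivative ?x') (at q)" by (rule smooth_on_has_derivative[OF smooth_x q])
    have n': "(n has_derivative ?n') (at q)" by (rule smooth_on_has_derivative[OF smooth_n q])
    \<comment> \<open>The derivative of \<delta> comes from two orthogonality relations. The foot
      stays in the zero set of \<rho>, so its derivative is orthogonal to \<open>n q\<close>; the
      derivative of the unit vector \<open>n\<close> is orthogonal to \<open>n q\<close> too, hence
      to \<open>q - x q\<close>. Only \<open>n q \<bullet> v\<close> survives.\<close>
    have "(\<lambda>v. ?G (x q) \<bullet> ?x' v) = (\<lambda>v. 0)"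
    proof (rule has_derivative_unique)
      show "((\<lambda>q. \<rho> (x q)) has_derivative (\<lambda>v. ?G (x q) \<bullet> ?x' v)) (at q)"
        by (rule has_derivative_compose[OF x' \<rho>_deriv[OF x_U0[OF q]]])
      show "((\<lambda>q. \<rho> (x q)) has_derivative (\<lambda>v. 0)) (at q)"
        by (rule has_derivative_transform_within_open[OF has_derivative_const[of 0] W0(1) q])
           (simp add: \<rho>_x)
    qed
    then have nx: "?x' v \<bullet> n q = 0" for v
      by (drule_tac fun_cong[where x = v]) (simp add: n_powr[OF q] inner_commute)
    have "(\<lambda>v. n q \<bullet> ?n' v + ?n' v \<bullet> n q) = (\<lambda>v. 0)"
    proof (rule has_derivative_unique)
      show "((\<lambda>q. n q \<bullet> n q) has_derivative (\<lambda>v. n q \<bullet> ?n' v + ?n' v \<bullet> n q)) (at q)"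
        by (rule has_derivative_inner[OF n' n'])
      show "((\<lambda>q. n q \<bullet> n q) has_derivative (\<lambda>v. 0)) (at q)"
        by (rule has_derivative_transform_within_open[OF has_derivative_const[of 1] W0(1) q])
           (simp add: dot_square_norm norm_n)
    qed
    then have nn: "n q \<bullet> ?n' v = 0" for v
      by (drule_tac fun_cong[where x = v]) (simp add: inner_commute)
    have "(\<delta> has_derivative (\<lambda>v. (q - x q) \<bullet> ?n' v + (v - ?x' v) \<bullet> n q)) (at q)"
      unfolding \<delta>_def
      by (rule has_derivative_inner[OF has_derivative_diff[OF has_derivative_ident x'] n'])
    moreover have "(q - x q) \<bullet> ?n' v + (v - ?x' v) \<bullet> n q = n q \<bullet> v" for v
      using nn[of v] nx[of v] by (simp add: \<delta>_n[OF q, symmetric] inner_diff_left inner_commute[of v])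
    ultimately show ?thesis by simp
  qed
  \<comment> \<open>Gradients at any two points near \<open>p0\<close> form an acute angle. A ball
    inside \<open>A \<inter> B\<close> is taken because it is convex and contains the segment from
    the foot to the point.\<close>
  obtain A B where AB: "open A" "open B" "p0 \<in> A" "p0 \<in> B"
    and pos: "\<And>y z. y \<in> A \<Longrightarrow> z \<in> B \<Longrightarrow> y \<in> U0 \<and> z \<in> U0 \<and> ?G y \<bullet> ?G z > 0"
  proof -
    let ?S = "{w \<in> U0 \<times> U0. ?G (fst w) \<bullet> ?G (snd w) \<in> {0<..}}"
    note contG = smooth_on_continuous_on[OF G]
    have "continuous_on (U0 \<times> U0) (\<lambda>w. ?G (fst w) \<bullet> ?G (snd w))"
      by (intro continuous_intros continuous_on_compose2[OF contG]) auto
    then have "open ?S"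
      using continuous_open_preimage[of "U0 \<times> U0" "\<lambda>w. ?G (fst w) \<bullet> ?G (snd w)" "{0<..}"] U0(1)
      by (simp add: open_Times vimage_def Int_def)
    moreover have "(p0, p0) \<in> ?S" using U0(2) nonsing by simp
    ultimately obtain A B where "open A" "open B" "(p0, p0) \<in> A \<times> B" "A \<times> B \<subseteq> ?S"
      by (rule open_prod_elim)
    then show thesis by (intro that[of A B]) auto
  qed
  obtain e where e: "e > 0" "ball p0 e \<subseteq> A \<inter> B"
    using AB openE[of "A \<inter> B" p0] by auto
  have ball_U0: "y \<in> U0" and ball_pos: "z \<in> ball p0 e \<Longrightarrow> ?G y \<bullet> ?G z > 0" if "y \<in> ball p0 e" for y z
    using pos[of y p0] pos[of y z] AB(4) subsetD[OF e(2), of y] subsetD[OF e(2), of z] that by auto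
  define W where "W = {q \<in> W0. x q \<in> ball p0 e} \<inter> ball p0 e"
  have W_W0: "W \<subseteq> W0" by (auto simp: W_def)
  have open_W: "open W"
    unfolding W_def
    using continuous_open_preimage[OF smooth_on_continuous_on[OF smooth_x] W0(1), of "ball p0 e"]
    by (intro open_Int open_ball) (simp add: vimage_def Int_def)
  have sd: "signed_distance W \<delta> n"
  proof (unfold_locales)
    show "open W" by (rule open_W)
    show "smooth_on W \<delta>" "smooth_on W n" using smooth_\<delta> smooth_n W_W0 smooth_on_subset by blast+
    fix q assume "q \<in> W"
    then have q: "q \<in> W0" using W_W0 by blast
    show "(\<delta> has_derivative (\<lambda>v. n q \<bullet> v)) (at q)" "norm (n q) = 1" using \<delta>_deriv norm_n q by auto
    assume "q - \<delta> q *\<^sub>R n q \<in> W"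
    then have "x q \<in> W0" using foot[OF q] W_W0 by auto
    then have "x (x q) = x q" using x_boundary \<rho>_x[OF q] by blast
    then show "n (q - \<delta> q *\<^sub>R n q) = n q" "\<delta> (q - \<delta> q *\<^sub>R n q) = 0"
      by (simp_all add: foot[OF q]) (simp_all add: n_def \<delta>_def)
  qed
  \<comment> \<open>Along the segment from \<open>x q\<close>, where \<rho> vanishes, the mean value
    theorem gives \<rho> as \<delta> times the inner product of two gradients at an acute angle, up
    to a positive norm.\<close>
  have sign: "\<exists>c>0. \<rho> q = \<delta> q * c" if q: "q \<in> W" for q
  proof -
    have q0: "q \<in> W0" and qe: "q \<in> ball p0 e" "x q \<in> ball p0 e" using q by (auto simp: W_def)
    let ?d = "q - x q"
    have seg: "x q + t *\<^sub>R ?d \<in> ball p0 e" if "0 \<le> t" "t \<le> 1" for t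
      using convexD_alt[OF convex_ball qe(2,1), of t] that by (simp add: algebra_simps)
    have "DERIV (\<lambda>t. \<rho> (x q + t *\<^sub>R ?d)) t :> ?G (x q + t *\<^sub>R ?d) \<bullet> ?d" if "0 \<le> t" "t \<le> 1" for t
      by (intro DERIV_along_line \<rho>_deriv ball_U0 seg that)
    from MVT2[OF zero_less_one this] obtain t where t: "0 < t" "t < 1"
      and "\<rho> (x q + 1 *\<^sub>R ?d) - \<rho> (x q + 0 *\<^sub>R ?d) = (1 - 0) * (?G (x q + t *\<^sub>R ?d) \<bullet> ?d)" by blast
    moreover define \<xi> where "\<xi> = x q + t *\<^sub>R ?d"
    ultimately have "\<rho> q = ?G \<xi> \<bullet> ?d" using \<rho>_x[OF q0] by simp
    also have "?d = (\<delta> q / norm (?G (x q))) *\<^sub>R ?G (x q)"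
      using \<delta>_n[OF q0] by (simp add: n_powr[OF q0])
    finally have "\<rho> q = \<delta> q * ((?G \<xi> \<bullet> ?G (x q)) / norm (?G (x q)))" by simp
    moreover have "?G \<xi> \<bullet> ?G (x q) > 0"
      unfolding \<xi>_def using t qe(2) by (intro ball_pos seg) simp_all
    ultimately show ?thesis using G_nz[OF x_U0[OF q0]]
      by (intro exI[of _ "(?G \<xi> \<bullet> ?G (x q)) / norm (?G (x q))"]) simp
  qed
  show thesis
  proof (rule that[OF sd])
    have "x p0 = p0" using x_boundary W0(2) \<rho>0 by blast
    then show "p0 \<in> W" using W0(2) e(1) by (simp add: W_def)
    show "W \<subseteq> U" using ball_U0 U0(3) by (auto simp: W_def)
    show "\<delta> q < 0 \<longleftrightarrow> \<rho> q < 0" "\<delta> q = 0 \<longleftrightarrow> \<rho> q = 0" if "q \<in> W" for q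
      using sign[OF that] by (auto simp: mult_less_0_iff)
  qed
qed

section \<open>Complex structure and Hessians\<close>


context signed_distance
begin

lemma delta_neg_nearby:
  assumes p: "p \<in> W" "\<delta> p = 0"
  shows "\<forall>\<^sub>F h in at_right 0. \<delta> (p - h *\<^sub>R n p) < 0"
proof -
  have "DERIV (\<lambda>s. \<delta> (p + s *\<^sub>R n p)) 0 :> n p \<bullet> n p"
    by (rule DERIV_along_line) (use delta_derivative[OF p(1)] in simp)
  moreover have "n p \<bullet> n p > 0" using norm_n[OF p(1)] by (simp add: dot_square_norm)
  ultimately have "\<exists>d>0. \<forall>h>0. h < d \<longrightarrow> \<delta> (p + (0 - h) *\<^sub>R n p) < \<delta> (p + 0 *\<^sub>R n p)"
    by (rule DERIV_pos_inc_left)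
  then obtain d where "d > 0" "\<And>h. 0 < h \<Longrightarrow> h < d \<Longrightarrow> \<delta> (p - h *\<^sub>R n p) < 0"
    using p(2) by auto
  then show ?thesis by (auto simp: eventually_at_right_field)
qed

lemma eventually_inner_normal:
  assumes "open S" "p \<in> S"
  shows "\<forall>\<^sub>F h in at_right (0::real). p - h *\<^sub>R n p \<in> S"
proof -
  have "((\<lambda>h. p - h *\<^sub>R n p) \<longlongrightarrow> p - 0 *\<^sub>R n p) (at_right 0)"
    by (intro tendsto_intros)
  then show ?thesis using topological_tendstoD assms by fastforce
qed

text \<open>Moving along the inner normal makes \<delta> negative at once. This is what shows later
  that every zero of \<delta> is a limit of points of \<Omega>.\<close>

lemma mem_closure_negative:
  assumes p: "p \<in> W" "\<delta> p = 0"
  shows "p \<in> closure {q \<in> W. \<delta> q < 0}"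
proof (rule ccontr)
  assume "p \<notin> closure {q \<in> W. \<delta> q < 0}"
  then have "\<forall>\<^sub>F h in at_right 0. p - h *\<^sub>R n p \<in> - closure {q \<in> W. \<delta> q < 0}"
    by (intro eventually_inner_normal) auto
  then have "\<forall>\<^sub>F h in at_right (0::real). False"
    using delta_neg_nearby[OF p] eventually_inner_normal[OF open_W p(1)]
  proof eventually_elim
    case (elim h)
    then have "p - h *\<^sub>R n p \<in> {q \<in> W. \<delta> q < 0}" by simp
    from subsetD[OF closure_subset this] elim(1) show ?case by simp
  qed
  then show False by simp
qed

text \<open>Fixes the orientation: with a negative factor, \<open>r\<close> would be positive along
  the inner normal, where \<delta> and hence \<open>r\<close> are negative.\<close>

lemma grad_inner_n_pos:
  assumes p: "p \<in> W" "\<delta> p = 0" "p \<in> U"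
    and U: "open U" and r: "smooth_on U r" "r p = 0" "grad r p \<noteq> 0" "grad r p = (grad r p \<bullet> n p) *\<^sub>R n p"
    and neg: "\<And>q. q \<in> W \<Longrightarrow> q \<in> U \<Longrightarrow> \<delta> q < 0 \<Longrightarrow> r q < 0"
  shows "grad r p \<bullet> n p > 0"
proof (rule ccontr)
  assume "\<not> ?thesis"
  moreover have "grad r p \<bullet> n p \<noteq> 0" using r(3,4) by auto
  ultimately have "grad r p \<bullet> n p < 0" by simp
  have "DERIV (\<lambda>s. r (p + s *\<^sub>R n p)) 0 :> grad r p \<bullet> n p"
    unfolding grad_inner[OF smooth_on_differentiable[OF r(1) p(3)]]
    by (rule DERIV_along_line) (use smooth_on_has_derivative[OF r(1) p(3)] in simp)
  from DERIV_neg_dec_left[OF this \<open>grad r p \<bullet> n p < 0\<close>]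
  obtain d where "d > 0" "\<And>h. 0 < h \<Longrightarrow> h < d \<Longrightarrow> 0 < r (p - h *\<^sub>R n p)"
    using r(2) by auto
  then have "\<forall>\<^sub>F h in at_right 0. 0 < r (p - h *\<^sub>R n p)" by (auto simp: eventually_at_right_field)
  then have "\<forall>\<^sub>F h in at_right (0::real). False"
    using delta_neg_nearby[OF p(1,2)] eventually_inner_normal[OF open_W p(1)] eventually_inner_normal[OF U p(3)]
  proof eventually_elim
    case (elim h)
    then show ?case using neg[of "p - h *\<^sub>R n p"] by simp
  qed
  then show False by simp
qed

end

section \<open>Complex structure and a unitary frame\<close>

abbreviation mult_i :: "complex^2 \<Rightarrow> complex^2" where "mult_i v \<equiv> \<i> *s v"

text \<open>Applied to a normal vector this spans the complex tangent line. For
  \<open>v = grad r\<close> it is twice the classical tangential field with components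
  \<open>- r_w\<close> and \<open>r_z\<close>. It is conjugate-linear, hence real linear.\<close>

definition rot :: "complex^2 \<Rightarrow> complex^2" where
  "rot v = (\<chi> j. if j = 1 then - cnj (v $ 2) else cnj (v $ 1))"

lemma inner_complex2: "(v::complex^2) \<bullet> w = Re (v $ 1 * cnj (w $ 1) + v $ 2 * cnj (w $ 2))"
  by (simp add: inner_vec_def sum_2 inner_complex_def)

lemma bounded_linear_rot: "bounded_linear rot"
  by (intro linear_conv_bounded_linear[THEN iffD1] linearI) (auto simp: rot_def vec_eq_iff)

lemma rot_scaleR: "rot (c *\<^sub>R v) = c *\<^sub>R rot v"
  by (simp add: rot_def vec_eq_iff)

lemma inner_rot: "v \<bullet> rot v = 0" "v \<bullet> mult_i (rot v) = 0"
  by (simp_all add: inner_complex2 rot_def algebra_simps)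

lemma inner_mult_i: "v \<bullet> mult_i v = 0" "mult_i v \<bullet> w = - (v \<bullet> mult_i w)"
  by (simp_all add: inner_complex2 algebra_simps)

lemma norm_mult_i: "norm (mult_i v) = norm v"
  by (simp add: norm_vec_def norm_mult)

lemma complex_scale_eq: "c *s (v::complex^2) = Re c *\<^sub>R v + Im c *\<^sub>R mult_i v"
  by (simp add: vec_eq_iff complex_eq_iff)

text \<open>The coefficient of \<open>\<nu>\<close> is the Hermitian product of \<open>A\<close>
  with \<open>\<nu>\<close>, whose real and imaginary parts are the two real inner products. The
  other coefficient is the determinant of \<open>\<nu>\<close> and \<open>A\<close>.\<close>

lemma unitary_frame_expansion:
  assumes "norm \<nu> = 1"
  obtains a where "A = a *s rot \<nu> + Complex (A \<bullet> \<nu>) (A \<bullet> mult_i \<nu>) *s \<nu>"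
proof -
  have "\<nu> \<bullet> \<nu> = 1" using assms by (simp add: dot_square_norm)
  then have 1: "\<nu> $ 1 * cnj (\<nu> $ 1) + \<nu> $ 2 * cnj (\<nu> $ 2) = 1"
    by (simp add: inner_complex2 complex_eq_iff)
  have b: "Complex (A \<bullet> \<nu>) (A \<bullet> mult_i \<nu>) = A $ 1 * cnj (\<nu> $ 1) + A $ 2 * cnj (\<nu> $ 2)"
    by (simp add: inner_complex2 complex_eq_iff)
  define a where "a = A $ 2 * \<nu> $ 1 - A $ 1 * \<nu> $ 2"
  have "A $ 1 = A $ 1 * (\<nu> $ 1 * cnj (\<nu> $ 1) + \<nu> $ 2 * cnj (\<nu> $ 2))"
    "A $ 2 = A $ 2 * (\<nu> $ 1 * cnj (\<nu> $ 1) + \<nu> $ 2 * cnj (\<nu> $ 2))"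
    unfolding 1 by simp_all
  then have "A = a *s rot \<nu> + Complex (A \<bullet> \<nu>) (A \<bullet> mult_i \<nu>) *s \<nu>"
    unfolding b by (simp add: vec_eq_iff forall_2 rot_def a_def algebra_simps)
  then show thesis by (rule that)
qed

lemma real_hessian_eq:
  assumes "open U" "smooth_on U f" "p \<in> U"
  shows "real_hessian f p V W = frechet_derivative (grad f) (at p) V \<bullet> W"
proof -
  let ?D = "frechet_derivative (grad f) (at p)"
  have lin: "linear ?D"
    by (rule smooth_on_linear_derivative[OF smooth_on_grad[OF assms(1,2)] assms(3)])
  have "real_hessian f p V W = (\<Sum>a\<in>Basis. (V \<bullet> a) * (\<Sum>b\<in>Basis. (?D a \<bullet> b) * (W \<bullet> b)))"
    unfolding real_hessian_def grad_derivative_inner[OF assms, symmetric]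
    by (simp add: sum_distrib_left mult_ac)
  also have "\<dots> = (\<Sum>a\<in>Basis. (V \<bullet> a) *\<^sub>R ?D a) \<bullet> W"
    by (simp add: euclidean_inner[symmetric] inner_sum_left)
  finally show ?thesis using linear_basis_expansion[OF lin, of V] by simp
qed

lemma d_z_of_real:
  assumes "f differentiable (at p)"
  shows "d_z j (\<lambda>q. complex_of_real (f q)) p = cnj (grad f p $ j) / 2"
    and "d_zbar j (\<lambda>q. complex_of_real (f q)) p = grad f p $ j / 2"
proof -
  have "((\<lambda>q. complex_of_real (f q)) has_derivative (\<lambda>v. complex_of_real (frechet_derivative f (at p) v))) (at p)"
    using assms frechet_derivative_works by (blast intro: has_derivative_of_real)
  from frechet_derivative_at[OF this]
  have D: "frechet_derivative (\<lambda>q. complex_of_real (f q)) (at p) v = complex_of_real (grad f p \<bullet> v)" for v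
    by (metis grad_inner[OF assms])
  have "grad f p $ j = Complex (grad f p \<bullet> axis j 1) (grad f p \<bullet> axis j \<i>)"
    by (simp add: inner_axis complex_eq_iff inner_complex_def)
  then show "d_z j (\<lambda>q. complex_of_real (f q)) p = cnj (grad f p $ j) / 2"
    "d_zbar j (\<lambda>q. complex_of_real (f q)) p = grad f p $ j / 2"
    unfolding d_z_def d_zbar_def D by (simp_all add: complex_eq_iff)
qed

text \<open>In the real Hessian the part of type (2,0) and its conjugate change sign when
  \<open>A\<close> is replaced by \<open>mult_i A\<close>, while the Hermitian part does not; the
  sum leaves four times the latter. The proof verifies this in the four real coordinates.\<close>

lemma complex_hessian_eq:
  assumes "open U" "smooth_on U f" "p \<in> U"
  defines "D \<equiv> frechet_derivative (grad f) (at p)"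
  shows "complex_hessian f p A A = complex_of_real ((D A \<bullet> A + D (mult_i A) \<bullet> mult_i A) / 4)"
proof -
  have lin: "linear D" unfolding D_def
    by (rule smooth_on_linear_derivative[OF smooth_on_grad[OF assms(1,2)] assms(3)])
  have sym: "D v \<bullet> w = D w \<bullet> v" for v w
    unfolding D_def by (rule grad_derivative_symmetric[OF assms(1-3)])
  have G: "(grad f has_derivative D) (at p)"
    unfolding D_def by (rule smooth_on_has_derivative[OF smooth_on_grad[OF assms(1,2)] assms(3)])
  have zbar: "frechet_derivative (d_zbar k (\<lambda>q. complex_of_real (f q))) (at p) = (\<lambda>v. D v $ k / 2)" for k
  proof (rule frechet_derivative_at[symmetric])
    have "((\<lambda>q. grad f q $ k / 2) has_derivative (\<lambda>v. D v $ k / 2)) (at p)"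
      by (rule bounded_linear.has_derivative[OF bounded_linear_compose[OF bounded_linear_divide bounded_linear_vec_nth] G])
    then show "(d_zbar k (\<lambda>q. complex_of_real (f q)) has_derivative (\<lambda>v. D v $ k / 2)) (at p)"
      by (rule has_derivative_transform_within_open[OF _ assms(1,3)])
         (simp add: d_z_of_real(2)[OF smooth_on_differentiable[OF assms(2)]])
  qed
  define h where "h = (\<lambda>v w. D v \<bullet> w)"
  have nth: "D v $ k = Complex (h v (axis k 1)) (h v (axis k \<i>))" for v k
    by (simp add: h_def inner_axis complex_eq_iff inner_complex_def)
  have hadd: "h (v + w) u = h v u + h w u" "h u (v + w) = h u v + h u w"
    "h (c *\<^sub>R v) u = c * h v u" "h u (c *\<^sub>R v) = c * h u v" for u v w c
    by (simp_all add: h_def linear_add[OF lin] linear_scale[OF lin] inner_add_left inner_add_right)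
  have hsym: "h v w = h w v" for v w unfolding h_def by (rule sym)
  let ?x1 = "axis 1 1 :: complex^2" and ?y1 = "axis 1 \<i> :: complex^2"
  let ?x2 = "axis 2 1 :: complex^2" and ?y2 = "axis 2 \<i> :: complex^2"
  define a1 b1 a2 b2 where "a1 = Re (A $ 1)" and "b1 = Im (A $ 1)" and "a2 = Re (A $ 2)" and "b2 = Im (A $ 2)"
  have nth_A: "A $ 1 = Complex a1 b1" "A $ 2 = Complex a2 b2"
    by (simp_all add: a1_def b1_def a2_def b2_def)
  have A: "A = a1 *\<^sub>R ?x1 + (b1 *\<^sub>R ?y1 + (a2 *\<^sub>R ?x2 + b2 *\<^sub>R ?y2))"
    and iA: "mult_i A = (- b1) *\<^sub>R ?x1 + (a1 *\<^sub>R ?y1 + ((- b2) *\<^sub>R ?x2 + a2 *\<^sub>R ?y2))"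
    by (simp_all add: vec_eq_iff forall_2 axis_def complex_eq_iff nth_A)
  \<comment> \<open>Symmetry would loop as a rewrite rule; these six instances orient each mixed
    pair once.\<close>
  note flip = hsym[of ?y1 ?x1] hsym[of ?x2 ?x1] hsym[of ?y2 ?x1] hsym[of ?x2 ?y1] hsym[of ?y2 ?y1] hsym[of ?y2 ?x2]
  have hq: "h (a *\<^sub>R ?x1 + (b *\<^sub>R ?y1 + (c *\<^sub>R ?x2 + d *\<^sub>R ?y2)))
      (a *\<^sub>R ?x1 + (b *\<^sub>R ?y1 + (c *\<^sub>R ?x2 + d *\<^sub>R ?y2))) =
      a * a * h ?x1 ?x1 + b * b * h ?y1 ?y1 + c * c * h ?x2 ?x2 + d * d * h ?y2 ?y2 +
      2 * (a * b * h ?x1 ?y1 + a * c * h ?x1 ?x2 + a * d * h ?x1 ?y2 +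
        b * c * h ?y1 ?x2 + b * d * h ?y1 ?y2 + c * d * h ?x2 ?y2)" for a b c d
    unfolding hadd flip by (simp add: algebra_simps)
  have "complex_hessian f p A A = complex_of_real ((h A A + h (mult_i A) (mult_i A)) / 4)"
    unfolding hq[of a1 b1 a2 b2, folded A] hq[of "- b1" a1 "- b2" a2, folded iA]
      complex_hessian_def d_z_def zbar nth sum_2 nth_A flip
    by (simp add: complex_eq_iff field_simps)
  then show ?thesis by (simp add: h_def)
qed


section \<open>Levi forms of real symmetric maps\<close>

definition levi_form :: "(complex^2 \<Rightarrow> complex^2) \<Rightarrow> complex^2 \<Rightarrow> real" where
  "levi_form D v = D v \<bullet> v + D (mult_i v) \<bullet> mult_i v"

lemma mult_i_complex_scale: "mult_i (c *s v) = Re c *\<^sub>R mult_i v - Im c *\<^sub>R v"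
  by (simp add: vec_eq_iff complex_eq_iff)

text \<open>Multiplication by \<open>c\<close> rotates and scales the pair \<open>v\<close>,
  \<open>mult_i v\<close>, and the sum of squares of a linear functional over the pair notices only
  the scaling. So the complex factor between a tangential field and \<open>rot (n p)\<close> will
  cancel.\<close>

lemma sum_squares_complex_scale:
  assumes "linear D"
  shows "(D (c *s v) \<bullet> t)\<^sup>2 + (D (mult_i (c *s v)) \<bullet> t)\<^sup>2 =
    (cmod c)\<^sup>2 * ((D v \<bullet> t)\<^sup>2 + (D (mult_i v) \<bullet> t)\<^sup>2)"
  unfolding mult_i_complex_scale unfolding complex_scale_eq[of c v] cmod_power2
  using assms
  by (simp add: linear_add linear_scale linear_neg linear_diff inner_add_left inner_diff_left
      power2_eq_square algebra_simps)

lemma levi_form_complex_scale: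
  assumes lin: "linear D" and sym: "\<And>v w. D v \<bullet> w = D w \<bullet> v"
  shows "levi_form D (c *s v) = (cmod c)\<^sup>2 * levi_form D v"
  unfolding levi_form_def mult_i_complex_scale unfolding complex_scale_eq[of c v] cmod_power2
  using sym[of "mult_i v" v]
  by (simp add: linear_add[OF lin] linear_scale[OF lin] linear_neg[OF lin] linear_diff[OF lin]
      inner_add_left inner_diff_left inner_add_right inner_diff_right power2_eq_square algebra_simps)

lemma levi_form_mono:
  assumes "\<And>v. D v \<bullet> v \<le> D' v \<bullet> v"
  shows "levi_form D A \<le> levi_form D' A"
  unfolding levi_form_def using assms by (intro add_mono)

text \<open>In the frame of \<open>rot \<nu>\<close> and \<open>\<nu>\<close>, all terms with
  \<open>\<nu>\<close> itself vanish. There remain the tangential term \<open>?a * H\<close>, the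
  mixed term \<open>2 * S\<close> and a term in \<open>mult_i \<nu>\<close>. By
  \<open>sesqui\<close> the mixed term is at most \<open>?a * H + ?b * K\<close>: it consumes
  exactly the tangential term and costs K in the normal one.\<close>

lemma levi_form_lower_bound:
  assumes lin: "linear D" and sym: "\<And>v w. D v \<bullet> w = D w \<bullet> v"
    and \<nu>: "norm \<nu> = 1" "D \<nu> = 0"
    and levi: "0 \<le> levi_form D (rot \<nu>)" and K: "0 \<le> K"
    and sesqui: "(D (rot \<nu>) \<bullet> mult_i \<nu>)\<^sup>2 + (D (mult_i (rot \<nu>)) \<bullet> mult_i \<nu>)\<^sup>2 \<le> K * levi_form D (rot \<nu>)"
    and M: "\<And>v. norm (D v) \<le> M * norm v"
  shows "- (K + M) * ((A \<bullet> \<nu>)\<^sup>2 + (A \<bullet> mult_i \<nu>)\<^sup>2) \<le> levi_form D A"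
proof -
  define h where "h = (\<lambda>v w. D v \<bullet> w)"
  have hadd: "h (v + w) u = h v u + h w u" "h u (v + w) = h u v + h u w"
    "h (c *\<^sub>R v) u = c * h v u" "h u (c *\<^sub>R v) = c * h u v" for u v w c
    by (simp_all add: h_def linear_add[OF lin] linear_scale[OF lin] inner_add_left inner_add_right)
  have hsym: "h v w = h w v" for v w unfolding h_def by (rule sym)
  have h\<nu>: "h \<nu> v = 0" "h v \<nu> = 0" for v
    unfolding hsym[of v \<nu>] by (simp_all add: h_def \<nu>(2))
  let ?E = "rot \<nu>" and ?F = "mult_i (rot \<nu>)" and ?T = "mult_i \<nu>"
  define b1 b2 where "b1 = A \<bullet> \<nu>" and "b2 = A \<bullet> ?T"
  obtain a where "A = a *s ?E + Complex b1 b2 *s \<nu>"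
    using unitary_frame_expansion[OF \<nu>(1), of A] by (auto simp: b1_def b2_def)
  moreover define a1 a2 where "a1 = Re a" and "a2 = Im a"
  ultimately have A: "A = a1 *\<^sub>R ?E + (a2 *\<^sub>R ?F + (b1 *\<^sub>R \<nu> + b2 *\<^sub>R ?T))"
    and iA: "mult_i A = (- a2) *\<^sub>R ?E + (a1 *\<^sub>R ?F + ((- b2) *\<^sub>R \<nu> + b1 *\<^sub>R ?T))"
    by (simp_all add: vec_eq_iff complex_eq_iff algebra_simps)
  define H where "H = h ?E ?E + h ?F ?F"
  \<comment> \<open>The mixed terms are grouped by \<open>a1\<close> and \<open>a2\<close>, so that
    Cauchy-Schwarz separates the tangential from the normal coefficients.\<close>
  define u w where "u = b2 * h ?E ?T + b1 * h ?F ?T" and "w = b2 * h ?F ?T - b1 * h ?E ?T"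
  let ?b = "b1\<^sup>2 + b2\<^sup>2" and ?a = "a1\<^sup>2 + a2\<^sup>2"
  have hq: "h (x *\<^sub>R ?E + (y *\<^sub>R ?F + (z *\<^sub>R \<nu> + s *\<^sub>R ?T))) (x *\<^sub>R ?E + (y *\<^sub>R ?F + (z *\<^sub>R \<nu> + s *\<^sub>R ?T))) =
      x * x * h ?E ?E + y * y * h ?F ?F + s * s * h ?T ?T +
      2 * (x * y * h ?E ?F + x * s * h ?E ?T + y * s * h ?F ?T)" for x y z s
    unfolding hadd h\<nu> hsym[of ?F ?E] hsym[of ?T ?E] hsym[of ?T ?F] by (simp add: algebra_simps)
  have "levi_form D A = h A A + h (mult_i A) (mult_i A)" by (simp add: levi_form_def h_def)
  also have "\<dots> = ?a * H + 2 * (a1 * u + a2 * w) + ?b * h ?T ?T"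
    unfolding hq[of a1 a2 b1 b2, folded A] hq[of "- a2" a1 "- b2" b1, folded iA] H_def u_def w_def
    by (simp add: power2_eq_square algebra_simps)
  finally have eq: "levi_form D A = ?a * H + 2 * (a1 * u + a2 * w) + ?b * h ?T ?T" .
  have H: "0 \<le> H" using levi by (simp add: H_def h_def levi_form_def)
  define S where "S = a1 * u + a2 * w"
  have "S\<^sup>2 \<le> ?a * (u\<^sup>2 + w\<^sup>2)"
    unfolding S_def using zero_le_power2[of "a1 * w - a2 * u"] by (simp add: power2_eq_square algebra_simps)
  also have "u\<^sup>2 + w\<^sup>2 = ?b * ((h ?E ?T)\<^sup>2 + (h ?F ?T)\<^sup>2)"
    by (simp add: u_def w_def power2_eq_square algebra_simps)
  also have "?a * \<dots> \<le> ?a * (?b * (K * H))"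
    using sesqui by (intro mult_left_mono) (simp_all add: H_def h_def levi_form_def)
  finally have "(2 * S)\<^sup>2 \<le> 4 * ((?a * H) * (?b * K))"
    by (simp add: power_mult_distrib mult_ac)
  \<comment> \<open>The inequality of arithmetic and geometric means, with the weights that make the
    tangential term cancel exactly.\<close>
  also have "\<dots> \<le> (?a * H + ?b * K)\<^sup>2"
    using zero_le_power2[of "?a * H - ?b * K"] by (simp add: power2_eq_square algebra_simps)
  finally have "\<bar>2 * S\<bar> \<le> \<bar>?a * H + ?b * K\<bar>"
    unfolding abs_le_square_iff .
  also have "\<dots> = ?a * H + ?b * K"
    using H K by (intro abs_of_nonneg) simp
  finally have "\<bar>2 * S\<bar> \<le> ?a * H + ?b * K" .
  moreover have "\<bar>h ?T ?T\<bar> \<le> M"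
  proof -
    have "\<bar>h ?T ?T\<bar> \<le> norm (D ?T) * norm ?T" unfolding h_def by (rule Cauchy_Schwarz_ineq2)
    also have "\<dots> \<le> M" using M[of ?T] by (simp add: norm_mult_i \<nu>(1))
    finally show ?thesis .
  qed
  then have "?b * (- M) \<le> ?b * h ?T ?T" by (intro mult_left_mono) auto
  ultimately have "- (?b * K) - ?b * M \<le> levi_form D A" unfolding eq S_def[symmetric] by linarith
  then show ?thesis by (simp add: b1_def[symmetric] b2_def[symmetric] algebra_simps)
qed

lemma complex_hessian_levi_form:
  assumes "open U" "smooth_on U f" "p \<in> U"
  shows "complex_hessian f p A A = complex_of_real (levi_form (frechet_derivative (grad f) (at p)) A / 4)"
  unfolding levi_form_def by (rule complex_hessian_eq[OF assms])

lemma apply_10_eq: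
  assumes "f differentiable (at p)"
  shows "apply_10 A f p = Complex (grad f p \<bullet> A) (- (grad f p \<bullet> mult_i A)) / 2"
proof -
  have "im_part A = - mult_i A" by (simp add: im_part_def vec_eq_iff)
  then show ?thesis
    unfolding apply_10_decomposition[OF assms] grad_inner[OF assms, symmetric]
    by (simp add: re_part_def complex_eq_iff)
qed

text \<open>Vanishing on the boundary is a consequence of the sign condition: a positive value would
  persist on a neighbourhood, which would then miss \<Omega>.\<close>

lemma local_defining_boundary:
  assumes \<Omega>: "open \<Omega>" and U: "local_defining \<Omega> p0 U \<rho>" and p: "p \<in> frontier \<Omega>" "p \<in> U"
  shows "\<rho> p = 0" "grad \<rho> p \<noteq> 0"
proof -
  have oU: "open U" and \<rho>: "smooth_on U \<rho>" and neg: "\<And>q. q \<in> U \<Longrightarrow> q \<in> \<Omega> \<longleftrightarrow> \<rho> q < 0"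
    and D: "frechet_derivative \<rho> (at p) \<noteq> (\<lambda>v. 0)"
    using U p by (auto simp: local_defining_def)
  have "p \<notin> \<Omega>" using p(1) \<Omega> by (simp add: frontier_def interior_open)
  then have "\<not> \<rho> p < 0" using neg[OF p(2)] by simp
  moreover have "\<not> 0 < \<rho> p"
  proof
    assume "0 < \<rho> p"
    have open_pos: "open (U \<inter> \<rho> -` {0<..})"
      by (rule continuous_open_preimage[OF smooth_on_continuous_on[OF \<rho>] oU]) simp
    moreover have "p \<in> U \<inter> \<rho> -` {0<..}" using p(2) \<open>0 < \<rho> p\<close> by simp
    moreover have "p \<in> closure \<Omega>" using p(1) by (simp add: frontier_def)
    ultimately have "(U \<inter> \<rho> -` {0<..}) \<inter> \<Omega> \<noteq> {}"
      unfolding open_Int_closure_eq_empty[OF open_pos, of \<Omega>, symmetric] by blast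
    then obtain q where "q \<in> \<Omega>" "q \<in> U" "\<rho> q > 0" by auto
    then show False using neg[of q] by simp
  qed
  ultimately show "\<rho> p = 0" by simp
  show "grad \<rho> p \<noteq> 0"
  proof
    assume "grad \<rho> p = 0"
    then have "frechet_derivative \<rho> (at p) v = 0" for v
      using grad_inner[OF smooth_on_differentiable[OF \<rho> p(2)], of v] by simp
    with D show False by blast
  qed
qed

text \<open>Normalisation removes both the factor 1/2 of the complex derivatives and the size of the
  gradient, so every defining function yields the same T on the boundary.\<close>

lemma normal_10_eq:
  assumes "f differentiable (at p)" "grad f p = c *\<^sub>R \<nu>" "norm \<nu> = 1" "c > 0"
  shows "normal_10 f p = \<nu>"
proof -
  have "(\<Sum>j\<in>UNIV. (cmod (d_z j (\<lambda>q. complex_of_real (f q)) p))\<^sup>2) = (norm (grad f p) / 2)\<^sup>2"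
    unfolding d_z_of_real[OF assms(1)]
    by (simp add: norm_vec_def L2_set_def norm_divide power_divide sum_divide_distrib[symmetric] sum_nonneg)
  then have "normal_10 f p = (2 / norm (grad f p)) *\<^sub>R (\<chi> j. grad f p $ j / 2)"
    unfolding normal_10_def d_z_of_real[OF assms(1)] by simp
  also have "(\<chi> j. grad f p $ j / 2) = (1 / 2) *\<^sub>R grad f p"
    by (simp add: vec_eq_iff complex_eq_iff)
  also have "(2 / norm (grad f p)) *\<^sub>R \<dots> = (1 / c) *\<^sub>R grad f p"
    using assms(3,4) by (simp add: assms(2))
  finally show ?thesis using assms(2,4) by simp
qed

section \<open>The boundary estimate and the corrected distance\<close>


lemma (in signed_distance) Dn_bounded:
  assumes p0: "p0 \<in> W"
  obtains M where "M \<ge> 0" "\<forall>\<^sub>F p in nhds p0. \<forall>v. norm (Dn p v) \<le> M * norm v"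
proof -
  let ?f = "\<lambda>p. \<Sum>b\<in>Basis. norm (Dn p b)"
  define M where "M = ?f p0 + 1"
  have "isCont (\<lambda>p. Dn p b) p0" for b
    using smooth_on_continuous_on[OF smooth_on_frechet_derivative[OF smooth_n]]
      continuous_on_eq_continuous_at[OF open_W] p0 by blast
  then have "isCont ?f p0" by (intro continuous_intros)
  then have "(?f \<longlongrightarrow> ?f p0) (nhds p0)" by (simp add: isCont_def tendsto_nhds_iff)
  then have "\<forall>\<^sub>F p in nhds p0. ?f p < M" by (rule order_tendstoD) (simp add: M_def)
  moreover have "\<forall>\<^sub>F p in nhds p0. p \<in> W" using open_W p0 by (rule eventually_nhds_in_open)
  ultimately have "\<forall>\<^sub>F p in nhds p0. \<forall>v. norm (Dn p v) \<le> M * norm v"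
  proof eventually_elim
    case (elim p)
    show ?case
    proof
      fix v
      have "norm (Dn p v) = norm (\<Sum>b\<in>Basis. (v \<bullet> b) *\<^sub>R Dn p b)"
        using linear_basis_expansion[OF Dn_linear[OF elim(2)], of v] by (rule arg_cong)
      also have "\<dots> \<le> (\<Sum>b\<in>Basis. norm v * norm (Dn p b))"
        by (intro sum_norm_le) (simp add: mult_right_mono Basis_le_norm)
      also have "\<dots> = norm v * ?f p" by (simp add: sum_distrib_left)
      also have "\<dots> \<le> norm v * M" using elim(1) by (intro mult_left_mono) auto
      finally show "norm (Dn p v) \<le> M * norm v" by (simp add: mult.commute)
    qed
  qed
  moreover have "M \<ge> 0" by (simp add: M_def sum_nonneg add_nonneg_nonneg)
  ultimately show thesis by (rule that[rotated])
qed

locale signed_distance_C2 = signed_distance W \<delta> n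
  for W :: "(complex^2) set" and \<delta> n +
  fixes \<Omega> :: "(complex^2) set"
  assumes open_Omega: "open \<Omega>"
    and inside_iff: "\<And>q. q \<in> W \<Longrightarrow> q \<in> \<Omega> \<longleftrightarrow> \<delta> q < 0"
begin

lemma closure_nonpos:
  assumes p: "p \<in> W" "p \<in> closure \<Omega>"
  shows "\<delta> p \<le> 0"
proof (rule ccontr)
  assume "\<not> \<delta> p \<le> 0"
  have op: "open (W \<inter> \<delta> -` {0<..})"
    by (rule continuous_open_preimage[OF smooth_on_continuous_on[OF smooth_delta] open_W]) simp
  have "(W \<inter> \<delta> -` {0<..}) \<inter> \<Omega> = {}" using inside_iff by auto
  then have "(W \<inter> \<delta> -` {0<..}) \<inter> closure \<Omega> = {}"
    unfolding open_Int_closure_eq_empty[OF op] .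
  then show False using p \<open>\<not> \<delta> p \<le> 0\<close> by auto
qed

lemma frontier_iff:
  assumes p: "p \<in> W"
  shows "p \<in> frontier \<Omega> \<longleftrightarrow> \<delta> p = 0"
proof -
  have fr: "p \<in> frontier \<Omega> \<longleftrightarrow> p \<in> closure \<Omega> \<and> \<not> \<delta> p < 0"
    using inside_iff[OF p] open_Omega by (simp add: frontier_def interior_open)
  have "p \<in> closure \<Omega>" if "\<delta> p = 0"
  proof -
    have "{q \<in> W. \<delta> q < 0} \<subseteq> \<Omega>" using inside_iff by blast
    from closure_mono[OF this] show ?thesis using mem_closure_negative[OF p that] by blast
  qed
  then show ?thesis using fr closure_nonpos[OF p] by auto
qed

text \<open>Translates hypotheses about an arbitrary defining function into statements about
  \<delta>. Since \<open>n p\<close> is a unit vector, the factor is the norm of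
  \<open>grad r p\<close>.\<close>

lemma defining_function_relation:
  assumes U: "local_defining \<Omega> p0 U r" and p: "p \<in> W" "p \<in> U" "\<delta> p = 0"
  obtains \<mu> where "0 < \<mu>" "grad r p = \<mu> *\<^sub>R n p"
    "\<And>v w. v \<bullet> n p = 0 \<Longrightarrow> w \<bullet> n p = 0 \<Longrightarrow>
      frechet_derivative (grad r) (at p) v \<bullet> w = \<mu> * (Dn p v \<bullet> w)"
proof -
  have oU: "open U" and r: "smooth_on U r" and neg: "\<And>q. q \<in> U \<Longrightarrow> q \<in> \<Omega> \<longleftrightarrow> r q < 0"
    using U by (auto simp: local_defining_def)
  have r0: "r q = 0" if "q \<in> W" "q \<in> U" "\<delta> q = 0" for q
    using local_defining_boundary(1)[OF open_Omega U] frontier_iff that by blast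
  have par: "grad r p = (grad r p \<bullet> n p) *\<^sub>R n p"
    by (rule grad_parallel_n[OF oU r r0 p])
  have "grad r p \<noteq> 0"
    using local_defining_boundary(2)[OF open_Omega U] frontier_iff p by blast
  then have "0 < grad r p \<bullet> n p"
    using grad_inner_n_pos[OF p(1,3,2) oU r r0[OF p] _ par] inside_iff neg by blast
  from that[OF this par tangential_hessian[OF oU r r0 p]] show thesis .
qed

text \<open>X, Y and T are all orthogonal to the normal, so the proportionality of tangential
  Hessians covers every term in the hypotheses.\<close>

lemma tangential_frame:
  assumes "p \<in> W"
  shows "(c *s rot (n p)) \<bullet> n p = 0" "mult_i (c *s rot (n p)) \<bullet> n p = 0" "mult_i (n p) \<bullet> n p = 0"
  unfolding mult_i_complex_scale unfolding complex_scale_eq[of c]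
  using inner_rot[of "n p"] inner_mult_i(1)[of "n p"]
  by (simp_all add: inner_commute[of _ "n p"] inner_add_right inner_diff_right)

lemma levi_form_transfer:
  assumes p: "p \<in> W"
    and D: "\<And>v w. v \<bullet> n p = 0 \<Longrightarrow> w \<bullet> n p = 0 \<Longrightarrow> D v \<bullet> w = \<mu> * (Dn p v \<bullet> w)"
  shows "levi_form D (c *s rot (n p)) = \<mu> * ((cmod c)\<^sup>2 * levi_form (Dn p) (rot (n p)))"
  unfolding levi_form_complex_scale[OF Dn_linear[OF p] Dn_symmetric[OF p], of c "rot (n p)", symmetric]
  unfolding levi_form_def using D tangential_frame[OF p] by (simp add: distrib_left)

lemma levi_form_nonneg:
  assumes "pseudoconvex_at \<Omega> p0"
  shows "\<forall>\<^sub>F p in nhds p0. p \<in> W \<and> \<delta> p = 0 \<longrightarrow> 0 \<le> levi_form (Dn p) (rot (n p))"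
proof -
  obtain U r where U: "local_defining \<Omega> p0 U r"
    and psc: "\<And>L. holomorphic_tangential \<Omega> U r L \<Longrightarrow>
      (\<forall>\<^sub>F p in nhds p0. p \<in> frontier \<Omega> \<longrightarrow> 0 \<le> Re (complex_hessian r p (L p) (L p)))"
    using assms by (auto simp: pseudoconvex_at_def)
  have oU: "open U" "p0 \<in> U" and r: "smooth_on U r" using U by (auto simp: local_defining_def)
  \<comment> \<open>Pseudoconvexity is tested on one explicit field. One suffices, because the
    complex tangent space is a line.\<close>
  have "holomorphic_tangential \<Omega> U r (\<lambda>p. rot (grad r p))"
    unfolding holomorphic_tangential_def
    using smooth_on_linear_compose[OF oU(1) bounded_linear_rot smooth_on_grad[OF oU(1) r]]
      smooth_on_differentiable[OF r]
    by (auto simp: apply_10_eq inner_rot complex_eq_iff)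
  from psc[OF this] have
    "\<forall>\<^sub>F p in nhds p0. p \<in> frontier \<Omega> \<longrightarrow> 0 \<le> Re (complex_hessian r p (rot (grad r p)) (rot (grad r p)))" .
  with eventually_nhds_in_open[OF oU] show ?thesis
  proof eventually_elim
    case (elim p)
    show ?case
    proof (intro impI, elim conjE)
      assume p: "p \<in> W" "\<delta> p = 0"
      obtain \<mu> where \<mu>: "0 < \<mu>" "grad r p = \<mu> *\<^sub>R n p"
        "\<And>v w. v \<bullet> n p = 0 \<Longrightarrow> w \<bullet> n p = 0 \<Longrightarrow>
          frechet_derivative (grad r) (at p) v \<bullet> w = \<mu> * (Dn p v \<bullet> w)"
        by (rule defining_function_relation[OF U p(1) elim(1) p(2)]) blast
      have L: "rot (grad r p) = complex_of_real \<mu> *s rot (n p)"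
        by (simp add: \<mu>(2) rot_scaleR complex_scale_eq[of "complex_of_real \<mu>"])
      have "0 \<le> levi_form (frechet_derivative (grad r) (at p)) (rot (grad r p))"
        using elim(2) frontier_iff[OF p(1)] p(2) by (simp add: complex_hessian_levi_form[OF oU(1) r elim(1)])
      also have "\<dots> = \<mu> * ((cmod (complex_of_real \<mu>))\<^sup>2 * levi_form (Dn p) (rot (n p)))"
        unfolding L by (rule levi_form_transfer[OF p(1) \<mu>(3)])
      finally show "0 \<le> levi_form (Dn p) (rot (n p))"
        using \<mu>(1) by (simp add: zero_le_mult_iff)
    qed
  qed
qed

text \<open>Write \<open>L p = a *s rot (n p)\<close> and
  \<open>grad \<rho> p = \<mu> *\<^sub>R n p\<close>. The left side of the hypothesis scales with
  the squares of \<mu> and of \<open>cmod a\<close>, the right side with \<mu> and the square of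
  \<open>cmod a\<close>. The size of L cancels, and one factor \<mu> remains, which is bounded below
  near \<open>p0\<close>.\<close>

lemma sesquiconvex_estimate:
  assumes U: "local_defining \<Omega> p0 U \<rho>" and L: "holomorphic_tangential \<Omega> U \<rho> L" "\<And>p. p \<in> U \<Longrightarrow> L p \<noteq> 0"
    and bigO: "bigO_on (frontier \<Omega> \<inter> U)
      (\<lambda>p. (real_hessian \<rho> p (im_part (L p)) (im_part (normal_10 \<rho> p)))\<^sup>2 +
        (real_hessian \<rho> p (re_part (L p)) (im_part (normal_10 \<rho> p)))\<^sup>2)
      (\<lambda>p. complex_hessian \<rho> p (L p) (L p))"
    and p0: "p0 \<in> frontier \<Omega>"
  obtains K where "0 \<le> K"
    "\<forall>\<^sub>F p in nhds p0. p \<in> W \<and> \<delta> p = 0 \<and> 0 \<le> levi_form (Dn p) (rot (n p)) \<longrightarrow>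
      (Dn p (rot (n p)) \<bullet> mult_i (n p))\<^sup>2 + (Dn p (mult_i (rot (n p))) \<bullet> mult_i (n p))\<^sup>2
        \<le> K * levi_form (Dn p) (rot (n p))"
proof -
  have oU: "open U" "p0 \<in> U" and \<rho>: "smooth_on U \<rho>" using U by (auto simp: local_defining_def)
  \<comment> \<open>A closed ball inside \<open>U\<close> meets the boundary in a compact set, on
    which the order symbol supplies one constant.\<close>
  obtain e where e: "e > 0" "cball p0 e \<subseteq> U" using open_contains_cball oU by blast
  have "compact (frontier \<Omega> \<inter> cball p0 e)" by (intro closed_Int_compact) auto
  moreover have "closure (frontier \<Omega> \<inter> cball p0 e) = frontier \<Omega> \<inter> cball p0 e"
    by (simp add: closed_Int)
  ultimately obtain C where C: "C > 0" and est: "\<And>p. p \<in> frontier \<Omega> \<inter> cball p0 e \<Longrightarrow>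
      norm ((real_hessian \<rho> p (im_part (L p)) (im_part (normal_10 \<rho> p)))\<^sup>2 +
        (real_hessian \<rho> p (re_part (L p)) (im_part (normal_10 \<rho> p)))\<^sup>2)
      \<le> C * norm (complex_hessian \<rho> p (L p) (L p))"
    using bigO e(2) unfolding bigO_on_def by (metis inf_mono order_refl)
  define m where "m = norm (grad \<rho> p0) / 2"
  have m: "m > 0" using local_defining_boundary(2)[OF open_Omega U p0 oU(2)] by (simp add: m_def)
  have "isCont (\<lambda>p. norm (grad \<rho> p)) p0"
    using smooth_on_continuous_on[OF smooth_on_grad[OF oU(1) \<rho>]] oU
    by (intro continuous_norm) (simp add: continuous_on_eq_continuous_at)
  then have "((\<lambda>p. norm (grad \<rho> p)) \<longlongrightarrow> norm (grad \<rho> p0)) (nhds p0)"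
    by (simp add: isCont_def tendsto_nhds_iff)
  then have "\<forall>\<^sub>F p in nhds p0. m < norm (grad \<rho> p)"
    by (rule order_tendstoD) (use m in \<open>simp add: m_def\<close>)
  moreover have "\<forall>\<^sub>F p in nhds p0. p \<in> ball p0 e"
    by (rule eventually_nhds_in_open) (use e(1) in auto)
  ultimately have "\<forall>\<^sub>F p in nhds p0. p \<in> W \<and> \<delta> p = 0 \<and> 0 \<le> levi_form (Dn p) (rot (n p)) \<longrightarrow>
      (Dn p (rot (n p)) \<bullet> mult_i (n p))\<^sup>2 + (Dn p (mult_i (rot (n p))) \<bullet> mult_i (n p))\<^sup>2
        \<le> C / (4 * m) * levi_form (Dn p) (rot (n p))"
  proof eventually_elim
    case (elim p)
    show ?case
    proof (intro impI, elim conjE)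
      assume p: "p \<in> W" "\<delta> p = 0" and levi: "0 \<le> levi_form (Dn p) (rot (n p))"
      have pU: "p \<in> U" using elim(2) e(2) by auto
      have fr: "p \<in> frontier \<Omega>" using frontier_iff p by blast
      let ?D = "frechet_derivative (grad \<rho>) (at p)"
      define S where "S = (Dn p (rot (n p)) \<bullet> mult_i (n p))\<^sup>2 + (Dn p (mult_i (rot (n p))) \<bullet> mult_i (n p))\<^sup>2"
      define H where "H = levi_form (Dn p) (rot (n p))"
      obtain \<mu> where \<mu>: "0 < \<mu>" "grad \<rho> p = \<mu> *\<^sub>R n p"
        "\<And>v w. v \<bullet> n p = 0 \<Longrightarrow> w \<bullet> n p = 0 \<Longrightarrow> ?D v \<bullet> w = \<mu> * (Dn p v \<bullet> w)"
        by (rule defining_function_relation[OF U p(1) pU p(2)]) blast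
      have diff: "\<rho> differentiable (at p)" by (rule smooth_on_differentiable[OF \<rho> pU])
      have lin: "linear ?D"
        by (rule smooth_on_linear_derivative[OF smooth_on_grad[OF oU(1) \<rho>] pU])
      have N: "normal_10 \<rho> p = n p" by (rule normal_10_eq[OF diff \<mu>(2) norm_n[OF p(1)] \<mu>(1)])
      have "apply_10 (L p) \<rho> p = 0" using L(1) fr pU by (auto simp: holomorphic_tangential_def)
      then have "L p \<bullet> n p = 0" "L p \<bullet> mult_i (n p) = 0"
        using \<mu>(1) inner_mult_i(2)[of "n p" "L p"]
        by (simp_all add: apply_10_eq[OF diff] \<mu>(2) complex_eq_iff inner_commute)
      moreover obtain a where "L p = a *s rot (n p) + Complex (L p \<bullet> n p) (L p \<bullet> mult_i (n p)) *s n p"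
        by (rule unitary_frame_expansion[OF norm_n[OF p(1)], of "L p"])
      ultimately have Lp: "L p = a *s rot (n p)" by (simp add: vec_eq_iff Complex_eq_0)
      then have a: "a \<noteq> 0" using L(2)[OF pU] by auto
      have im: "im_part v = - mult_i v" for v by (simp add: im_part_def vec_eq_iff)
      note frame = tangential_frame(1,2)[OF p(1), of a] tangential_frame(3)[OF p(1)]
      have "(real_hessian \<rho> p (im_part (L p)) (im_part (normal_10 \<rho> p)))\<^sup>2 +
          (real_hessian \<rho> p (re_part (L p)) (im_part (normal_10 \<rho> p)))\<^sup>2 =
          (?D (mult_i (L p)) \<bullet> mult_i (n p))\<^sup>2 + (?D (L p) \<bullet> mult_i (n p))\<^sup>2"
        unfolding real_hessian_eq[OF oU(1) \<rho> pU] N im re_part_def by (simp add: linear_neg[OF lin])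
      also have "\<dots> = \<mu>\<^sup>2 * ((Dn p (L p) \<bullet> mult_i (n p))\<^sup>2 + (Dn p (mult_i (L p)) \<bullet> mult_i (n p))\<^sup>2)"
        unfolding Lp \<mu>(3)[OF frame(1,3)] \<mu>(3)[OF frame(2,3)]
        by (simp add: power_mult_distrib distrib_left)
      also have "\<dots> = \<mu>\<^sup>2 * ((cmod a)\<^sup>2 * S)"
        unfolding Lp sum_squares_complex_scale[OF Dn_linear[OF p(1)]] S_def ..
      finally have lhs: "(real_hessian \<rho> p (im_part (L p)) (im_part (normal_10 \<rho> p)))\<^sup>2 +
          (real_hessian \<rho> p (re_part (L p)) (im_part (normal_10 \<rho> p)))\<^sup>2 = \<mu>\<^sup>2 * ((cmod a)\<^sup>2 * S)" .
      have "levi_form ?D (L p) = \<mu> * ((cmod a)\<^sup>2 * H)"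
        unfolding Lp H_def by (rule levi_form_transfer[OF p(1) \<mu>(3)])
      then have "complex_hessian \<rho> p (L p) (L p) = complex_of_real (\<mu> * ((cmod a)\<^sup>2 * H) / 4)"
        by (simp only: complex_hessian_levi_form[OF oU(1) \<rho> pU])
      \<comment> \<open>Nonnegativity of the Levi form allows the norm to be dropped here, which is
        why it is a premise of the estimate.\<close>
      then have rhs: "norm (complex_hessian \<rho> p (L p) (L p)) = \<mu> * ((cmod a)\<^sup>2 * H) / 4"
        using \<mu>(1) levi by (simp only: norm_of_real H_def) simp
      have "norm (\<mu>\<^sup>2 * ((cmod a)\<^sup>2 * S)) \<le> C * (\<mu> * ((cmod a)\<^sup>2 * H) / 4)"
        using est[of p] fr elim(2) unfolding lhs rhs by simp
      then have "\<mu>\<^sup>2 * ((cmod a)\<^sup>2 * S) \<le> C * (\<mu> * ((cmod a)\<^sup>2 * H) / 4)" by simp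
      then have "(\<mu> * (cmod a)\<^sup>2) * (\<mu> * S) \<le> (\<mu> * (cmod a)\<^sup>2) * (C * H / 4)"
        by (simp add: power2_eq_square mult_ac)
      then have "\<mu> * S \<le> C * H / 4" using \<mu>(1) a by (simp add: mult_le_cancel_left_pos)
      moreover have "m * S \<le> \<mu> * S"
        using elim(1) \<mu>(1) by (intro mult_right_mono) (simp_all add: \<mu>(2) norm_n[OF p(1)] S_def)
      ultimately have "m * S \<le> C * H / 4" by linarith
      then show "S \<le> C / (4 * m) * H" using m by (simp add: field_simps)
    qed
  qed
  moreover have "0 \<le> C / (4 * m)" using C m by simp
  ultimately show thesis by (rule that[rotated])
qed

text \<open>The correction \<open>c / 2 * \<delta>\<^sup>2\<close> contributes \<open>c\<close> times the squared size of the complex normal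
  component of \<open>A\<close>, which absorbs the only negative term left by \<open>levi_form_lower_bound\<close>; that bound,
  valid at the foot point, is inherited by \<open>q\<close> because of \<open>Dn_foot_le\<close>.\<close>

lemma levi_form_corrected_nonneg:
  assumes q: "q \<in> W" "foot q \<in> W" "\<delta> q \<le> 0" "- \<delta> q * c \<le> 1"
    and levi: "0 \<le> levi_form (Dn (foot q)) (rot (n (foot q)))" and K: "0 \<le> K" and c: "c = K + M"
    and sesqui: "(Dn (foot q) (rot (n (foot q))) \<bullet> mult_i (n (foot q)))\<^sup>2 +
        (Dn (foot q) (mult_i (rot (n (foot q)))) \<bullet> mult_i (n (foot q)))\<^sup>2
        \<le> K * levi_form (Dn (foot q)) (rot (n (foot q)))"
    and M: "\<And>v. norm (Dn (foot q) v) \<le> M * norm v" "0 \<le> M"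
  shows "0 \<le> levi_form (\<lambda>v. (1 + c * \<delta> q) *\<^sub>R Dn q v + (c * (n q \<bullet> v)) *\<^sub>R n q) A"
proof -
  have nq: "n (foot q) = n q" by (rule n_foot[OF q(1,2)])
  let ?b = "(A \<bullet> n q)\<^sup>2 + (A \<bullet> mult_i (n q))\<^sup>2"
  have "- \<delta> q * M \<le> - \<delta> q * c" unfolding c using q(3) K by (intro mult_left_mono) auto
  then have M1: "- \<delta> q * M \<le> 1" using q(4) by linarith
  have "- c * ?b \<le> levi_form (Dn (foot q)) A"
    using levi_form_lower_bound[OF Dn_linear[OF q(2)] Dn_symmetric[OF q(2)] norm_n[OF q(2)] Dn_n[OF q(2)]
        levi K sesqui M(1), of A] unfolding nq c .
  also have "\<dots> \<le> levi_form (Dn q) A"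
    by (rule levi_form_mono[OF Dn_foot_le[OF q(1-3) M(1) M1]])
  finally have "(1 + c * \<delta> q) * (- c * ?b) \<le> (1 + c * \<delta> q) * levi_form (Dn q) A"
    using q(4) by (intro mult_left_mono) (simp_all add: mult.commute)
  \<comment> \<open>The scaled loss and the gain from the correction add up to
    \<open>- \<delta> q * (c * c * ?b)\<close>, which is nonnegative on the inner side.\<close>
  moreover have "0 \<le> - \<delta> q * (c * c * ?b)"
    using q(3) K M(2) by (intro mult_nonneg_nonneg) (simp_all add: c)
  ultimately have "0 \<le> (1 + c * \<delta> q) * levi_form (Dn q) A + c * ?b"
    by (simp add: algebra_simps)
  also have "\<dots> = levi_form (\<lambda>v. (1 + c * \<delta> q) *\<^sub>R Dn q v + (c * (n q \<bullet> v)) *\<^sub>R n q) A"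
    using inner_mult_i(2)[of "n q" A]
    by (simp add: levi_form_def inner_add_left inner_commute[of A] power2_eq_square algebra_simps)
  finally show ?thesis .
qed

end

theorem proposition7p10:
  fixes \<Omega> :: "(complex^2) set" and p0 :: "complex^2"
  assumes "smoothly_bounded_domain \<Omega>"
    and "p0 \<in> frontier \<Omega>"
    and "sesquiconvex_at \<Omega> p0"
  shows "\<exists>U \<rho>. local_defining \<Omega> p0 U \<rho> \<and> plurisubharmonic_on (closure \<Omega> \<inter> U) \<rho>"
proof -
  have \<Omega>: "open \<Omega>" using assms(1) by (simp add: smoothly_bounded_domain_def)
  obtain U \<rho> L where U: "local_defining \<Omega> p0 U \<rho>" "holomorphic_tangential \<Omega> U \<rho> L" "\<And>p. p \<in> U \<Longrightarrow> L p \<noteq> 0"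
    and psc: "pseudoconvex_at \<Omega> p0"
    and bigO: "bigO_on (frontier \<Omega> \<inter> U)
      (\<lambda>p. (real_hessian \<rho> p (im_part (L p)) (im_part (normal_10 \<rho> p)))\<^sup>2 +
        (real_hessian \<rho> p (re_part (L p)) (im_part (normal_10 \<rho> p)))\<^sup>2)
      (\<lambda>p. complex_hessian \<rho> p (L p) (L p))"
    using assms(3) unfolding sesquiconvex_at_def Let_def by blast
  have oU: "open U" "p0 \<in> U" and \<rho>: "smooth_on U \<rho>" and neg: "\<And>q. q \<in> U \<Longrightarrow> q \<in> \<Omega> \<longleftrightarrow> \<rho> q < 0"
    using U(1) by (auto simp: local_defining_def)
  note bd = local_defining_boundary[OF \<Omega> U(1) assms(2) oU(2)]
  obtain W \<delta> n where W: "signed_distance W \<delta> n" "p0 \<in> W" "W \<subseteq> U"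
    and sign: "\<And>q. q \<in> W \<Longrightarrow> \<delta> q < 0 \<longleftrightarrow> \<rho> q < 0" "\<And>q. q \<in> W \<Longrightarrow> \<delta> q = 0 \<longleftrightarrow> \<rho> q = 0"
    by (rule signed_distance_exists[OF oU \<rho> bd]) blast
  interpret signed_distance W \<delta> n by (rule W(1))
  interpret signed_distance_C2 W \<delta> n \<Omega>
    by unfold_locales (use \<Omega> sign(1) neg W(3) in auto)
  have \<delta>0: "\<delta> p0 = 0" using frontier_iff[OF W(2)] assms(2) by simp
  obtain K where K: "0 \<le> K"
    and sesqui: "\<forall>\<^sub>F p in nhds p0. p \<in> W \<and> \<delta> p = 0 \<and> 0 \<le> levi_form (Dn p) (rot (n p)) \<longrightarrow>
      (Dn p (rot (n p)) \<bullet> mult_i (n p))\<^sup>2 + (Dn p (mult_i (rot (n p))) \<bullet> mult_i (n p))\<^sup>2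
        \<le> K * levi_form (Dn p) (rot (n p))"
    by (rule sesquiconvex_estimate[OF U bigO assms(2)])
  obtain M where M: "0 \<le> M" and bound: "\<forall>\<^sub>F p in nhds p0. \<forall>v. norm (Dn p v) \<le> M * norm v"
    by (rule Dn_bounded[OF W(2)])
  have "\<forall>\<^sub>F p in nhds p0. p \<in> W \<and> \<delta> p = 0 \<longrightarrow>
      0 \<le> levi_form (Dn p) (rot (n p)) \<and>
      (Dn p (rot (n p)) \<bullet> mult_i (n p))\<^sup>2 + (Dn p (mult_i (rot (n p))) \<bullet> mult_i (n p))\<^sup>2
        \<le> K * levi_form (Dn p) (rot (n p)) \<and> (\<forall>v. norm (Dn p v) \<le> M * norm v)"
    using levi_form_nonneg[OF psc] sesqui bound by eventually_elim blast
  \<comment> \<open>The estimates hold at boundary points of \<open>S\<close> only; an inner point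
    uses them through its foot.\<close>
  then obtain S where S: "open S" "p0 \<in> S"
    and good: "\<And>p. p \<in> S \<Longrightarrow> p \<in> W \<Longrightarrow> \<delta> p = 0 \<Longrightarrow>
      0 \<le> levi_form (Dn p) (rot (n p)) \<and>
      (Dn p (rot (n p)) \<bullet> mult_i (n p))\<^sup>2 + (Dn p (mult_i (rot (n p))) \<bullet> mult_i (n p))\<^sup>2
        \<le> K * levi_form (Dn p) (rot (n p)) \<and> (\<forall>v. norm (Dn p v) \<le> M * norm v)"
    unfolding eventually_nhds by blast
  define c where "c = K + M"
  \<comment> \<open>Feet must land in \<open>S\<close>. The bound \<open>-1 < c * \<delta> q\<close>
    keeps \<open>1 + c * \<delta> q\<close> positive, so the gradient of \<open>r\<close> does not
    vanish and the estimate may be multiplied by this factor; it also keeps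
    \<open>1 + c * \<delta> q / 2\<close> positive, so \<open>r\<close> has the sign of
    \<delta>.\<close>
  define V where "V = {q \<in> W. foot q \<in> W \<inter> S} \<inter> (W \<inter> (\<lambda>q. c * \<delta> q) -` {-1<..<1})"
  have "continuous_on W (\<lambda>q. c * \<delta> q)"
    by (intro continuous_intros smooth_on_continuous_on smooth_delta)
  then have V: "open V"
    unfolding V_def by (intro open_Int open_foot_vimage continuous_open_preimage open_W S) auto
  have V_W: "V \<subseteq> W" by (auto simp: V_def)
  have p0V: "p0 \<in> V" using W(2) S(2) \<delta>0 by (simp add: V_def)
  have c\<delta>: "-1 < c * \<delta> q" "c * \<delta> q < 1" if "q \<in> V" for q using that by (auto simp: V_def)
  define r where "r = (\<lambda>q. \<delta> q + c / 2 * (\<delta> q * \<delta> q))"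
  have r_eq: "r q = \<delta> q * (1 + c * \<delta> q / 2)" for q by (simp add: r_def algebra_simps)
  have \<delta>_smooth: "smooth_on V \<delta>" using smooth_on_subset[OF smooth_delta V_W] .
  have r_smooth: "smooth_on V r"
    unfolding r_def
    by (intro smooth_on_add smooth_on_bilinear[OF _ bounded_bilinear_mult] smooth_on_const \<delta>_smooth V)
  have r_deriv: "(r has_derivative (\<lambda>v. ((1 + c * \<delta> q) *\<^sub>R n q) \<bullet> v)) (at q)" if "q \<in> V" for q
  proof -
    have "q \<in> W" using that V_W by blast
    from delta_derivative[OF this] show ?thesis
      unfolding r_def by (auto intro!: derivative_eq_intros simp: fun_eq_iff algebra_simps)
  qed
  have r_grad: "grad r q = (1 + c * \<delta> q) *\<^sub>R n q" if "q \<in> V" for q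
    by (rule grad_eqI[OF r_deriv[OF that]])
  have r_hess: "frechet_derivative (grad r) (at q) =
      (\<lambda>v. (1 + c * \<delta> q) *\<^sub>R Dn q v + (c * (n q \<bullet> v)) *\<^sub>R n q)" if q: "q \<in> V" for q
  proof (rule frechet_derivative_at[symmetric])
    have qW: "q \<in> W" using q V_W by blast
    have "((\<lambda>q. 1 + c * \<delta> q) has_derivative (\<lambda>v. c * (n q \<bullet> v))) (at q)"
      using delta_derivative[OF qW] by (auto intro!: derivative_eq_intros)
    from has_derivative_scaleR[OF this n_derivative[OF qW]]
    show "(grad r has_derivative (\<lambda>v. (1 + c * \<delta> q) *\<^sub>R Dn q v + (c * (n q \<bullet> v)) *\<^sub>R n q)) (at q)"
      by (rule has_derivative_transform_within_open[OF _ V q]) (simp add: r_grad)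
  qed
  have "local_defining \<Omega> p0 V r"
    unfolding local_defining_def
  proof (intro conjI ballI V p0V r_smooth)
    show "\<Omega> \<inter> V = {p \<in> V. r p < 0}"
    proof -
      have "q \<in> \<Omega> \<longleftrightarrow> r q < 0" if "q \<in> V" for q
        using inside_iff[of q] V_W that c\<delta>(1)[OF that] by (auto simp: r_eq mult_less_0_iff)
      then show ?thesis by blast
    qed
    fix q assume "q \<in> frontier \<Omega> \<inter> V"
    then have q: "q \<in> V" by blast
    then have "n q \<bullet> n q = 1" using norm_n[of q] V_W by (auto simp: dot_square_norm)
    then have "frechet_derivative r (at q) (n q) \<noteq> 0"
      using c\<delta>(1)[OF q] by (simp add: frechet_derivative_at[OF r_deriv[OF q], symmetric])
    then show "frechet_derivative r (at q) \<noteq> (\<lambda>v. 0)" by auto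
  qed
  moreover have "plurisubharmonic_on (closure \<Omega> \<inter> V) r"
    unfolding plurisubharmonic_on_def
  proof (intro ballI allI)
    fix q A assume "q \<in> closure \<Omega> \<inter> V"
    then have qV: "q \<in> V" and qW: "q \<in> W" and foot: "foot q \<in> W" "foot q \<in> S" and "\<delta> q \<le> 0"
      using closure_nonpos by (auto simp: V_def)
    note fine = good[OF foot(2,1) delta_foot[OF qW foot(1)]]
    have "0 \<le> levi_form (\<lambda>v. (1 + c * \<delta> q) *\<^sub>R Dn q v + (c * (n q \<bullet> v)) *\<^sub>R n q) A"
      by (rule levi_form_corrected_nonneg[OF qW foot(1) \<open>\<delta> q \<le> 0\<close> _ _ K c_def])
         (use fine M c\<delta>(1)[OF qV] in \<open>auto simp: mult.commute\<close>)
    then show "0 \<le> Re (complex_hessian r q A A)"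
      by (simp add: complex_hessian_levi_form[OF V r_smooth qV] r_hess[OF qV])
  qed
  ultimately show ?thesis by blast
qed

end
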